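(* Let $H$ be a fixed ordered graph with at most one edge. Then the Ordered Graph List-3-Coloring Problem restricted to $H$-free ordered graphs (i.e. to instances $(G,L)$ in which $G$ is $H$-free) is polynomial-time solvable.
   Context: All graphs are finite and simple. An ordered graph is a triple $G=(V,E,\varphi)$ where $(V,E)$ is a graph and $\varphi:V\to\mathbb{R}$ is injective. Ordered graphs $G=(V,E,\varphi)$ and $G'=(V',E',\varphi')$ are isomorphic if there is a bijection $f:V'\to V$ such that for all $v,w\in V'$: $\varphi'(v)<\varphi'(w)$ iff $\varphi(f(v))<\varphi(f(w))$, and $vw\in E'$ iff $f(v)f(w)\in E$. For $X\subseteq V$, $G[X]=(X,\{e\in E:e\subseteq X\},\varphi|_X)$. An ordered graph $H$ is an induced subgraph of $G$ if $H$ is isomorphic to $G[X]$ for some $X\subseteq V$; otherwise $G$ is $H$-free. A 3-list-assignment of $G$ is a map $L:V\to 2^{\{1,2,3\}}$. An $L$-coloring of $G$ is a map $\phi:V\to\{1,2,3\}$ with $\phi(u)\ne\phi(v)$ for every $uv\in E$ and $\phi(v)\in L(v)$ for every $v\in V$ (the ordering plays no role in the notion of coloring). The Ordered Graph List-3-Coloring Problem is: given an instance $(G,L)$ consisting of an ordered graph $G$ and a 3-list-assignment $L$ of $G$, decide whether $G$ admits an $L$-coloring. *)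

theory Defs
  imports Complex_Main "HOL-Computational_Algebra.Polynomial"
begin

section \<open>Ordered graphs\<close>

text \<open>Only the values of \<^term>\<open>ord\<close> on the vertex set matter; its values elsewhere are never
  inspected, so restricting an ordered graph to a vertex subset keeps \<^term>\<open>ord\<close> unchanged.\<close>

record 'a ograph =
  verts :: "'a set"
  edges :: "'a set set"
  ord :: "'a \<Rightarrow> real"

definition ordered_graph :: "'a ograph \<Rightarrow> bool" where
  "ordered_graph G \<longleftrightarrow>
     finite (verts G) \<and>
     (\<forall>e\<in>edges G. e \<subseteq> verts G \<and> card e = 2) \<and>
     inj_on (ord G) (verts G)"

definition isomorphic :: "'a ograph \<Rightarrow> 'b ograph \<Rightarrow> bool" where
  "isomorphic G G' \<longleftrightarrow>
     (\<exists>f. bij_betw f (verts G') (verts G) \<and>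
        (\<forall>v\<in>verts G'. \<forall>w\<in>verts G'.
           (ord G' v < ord G' w \<longleftrightarrow> ord G (f v) < ord G (f w)) \<and>
           ({v, w} \<in> edges G' \<longleftrightarrow> {f v, f w} \<in> edges G)))"

definition induced :: "'a ograph \<Rightarrow> 'a set \<Rightarrow> 'a ograph" where
  "induced G X = \<lparr>verts = X, edges = {e \<in> edges G. e \<subseteq> X}, ord = ord G\<rparr>"

definition induced_subgraph :: "'b ograph \<Rightarrow> 'a ograph \<Rightarrow> bool" where
  "induced_subgraph H G \<longleftrightarrow> (\<exists>X\<subseteq>verts G. isomorphic H (induced G X))"

definition free :: "'b ograph \<Rightarrow> 'a ograph \<Rightarrow> bool" where
  "free H G \<longleftrightarrow> \<not> induced_subgraph H G"


section \<open>List-3-colouring\<close>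

definition list_assignment3 :: "'a ograph \<Rightarrow> ('a \<Rightarrow> nat set) \<Rightarrow> bool" where
  "list_assignment3 G L \<longleftrightarrow> (\<forall>v\<in>verts G. L v \<subseteq> {1, 2, 3})"

definition list_coloring :: "'a ograph \<Rightarrow> ('a \<Rightarrow> nat set) \<Rightarrow> ('a \<Rightarrow> nat) \<Rightarrow> bool" where
  "list_coloring G L c \<longleftrightarrow>
     (\<forall>v\<in>verts G. c v \<in> {1, 2, 3} \<and> c v \<in> L v) \<and>
     (\<forall>u v. {u, v} \<in> edges G \<longrightarrow> c u \<noteq> c v)"

text \<open>Problem instances are graphs whose vertices are natural numbers, which covers every finite
  graph up to isomorphism; the vertex set and the injection into the reals are arbitrary.\<close>

type_synonym inst = "nat ograph \<times> (nat \<Rightarrow> nat set)"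

definition list3col_instances :: "inst set" where
  "list3col_instances = {(G, L). ordered_graph G \<and> list_assignment3 G L}"

definition list3col_yes :: "inst \<Rightarrow> bool" where
  "list3col_yes = (\<lambda>(G, L). \<exists>c. list_coloring G L c)"

text \<open>The input string for an instance with \<open>n\<close> vertices, listed as \<open>v\<^sub>1, \<dots>, v\<^sub>n\<close> by increasing
  value of \<^term>\<open>ord\<close>: the number \<open>n\<close> in unary with an end marker, the rows of the adjacency
  matrix, and three membership bits for each list. Real numbers cannot be written down; the order
  in which the vertices are listed carries all the information about the ordering.\<close>

definition ordered_verts :: "'a ograph \<Rightarrow> 'a list" where
  "ordered_verts G = map (inv_into (verts G) (ord G)) (sorted_list_of_set (ord G ` verts G))"

definition encode :: "inst \<Rightarrow> bool list" where
  "encode = (\<lambda>(G, L). let vs = ordered_verts G in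
     replicate (length vs) True @ [False] @
     concat (map (\<lambda>u. map (\<lambda>v. {u, v} \<in> edges G) vs) vs) @
     concat (map (\<lambda>v. map (\<lambda>i. i \<in> L v) [1, 2, 3]) vs))"


section \<open>Polynomial time\<close>

text \<open>The model of computation is the random access machine of Cook and Reckhow (Time bounded
  random access machines, 1973) at unit cost: registers hold natural numbers, and the only
  arithmetic is addition and (truncated) subtraction. Apart from loading a constant of the
  program, one step lengthens the largest number by at most one bit, so that \<open>t\<close> steps of
  such a machine are simulated by a Turing machine in time polynomial in \<open>t\<close> and the input
  length, and conversely; multiplication is left out because it
  would destroy this equivalence at unit cost. The input is a string of bits, kept apart from the
  registers and read by position; a position beyond its end reads as 0.\<close>

datatype instr =
    Const nat nat    \<comment> \<open>\<open>Const r k\<close>: \<open>R[r] := k\<close>\<close>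
  | Add nat nat nat  \<comment> \<open>\<open>Add r i j\<close>: \<open>R[r] := R[i] + R[j]\<close>\<close>
  | Sub nat nat nat  \<comment> \<open>\<open>Sub r i j\<close>: \<open>R[r] := R[i] - R[j]\<close>\<close>
  | Load nat nat     \<comment> \<open>\<open>Load r i\<close>: \<open>R[r] := R[R[i]]\<close>\<close>
  | Store nat nat    \<comment> \<open>\<open>Store i r\<close>: \<open>R[R[i]] := R[r]\<close>\<close>
  | Read nat nat     \<comment> \<open>\<open>Read r i\<close>: \<open>R[r] :=\<close> input bit at position \<open>R[i]\<close>\<close>
  | JumpZero nat nat \<comment> \<open>\<open>JumpZero r l\<close>: if \<open>R[r] = 0\<close> continue at instruction \<open>l\<close>\<close>

type_synonym program = "instr list"
type_synonym config = "nat \<times> (nat \<Rightarrow> nat)" \<comment> \<open>program counter and registers\<close>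

fun exec :: "bool list \<Rightarrow> instr \<Rightarrow> config \<Rightarrow> config" where
  "exec w (Const r k) (pc, R) = (Suc pc, R(r := k))"
| "exec w (Add r i j) (pc, R) = (Suc pc, R(r := R i + R j))"
| "exec w (Sub r i j) (pc, R) = (Suc pc, R(r := R i - R j))"
| "exec w (Load r i) (pc, R) = (Suc pc, R(r := R (R i)))"
| "exec w (Store i r) (pc, R) = (Suc pc, R(R i := R r))"
| "exec w (Read r i) (pc, R) = (Suc pc, R(r := of_bool (R i < length w \<and> w ! R i)))"
| "exec w (JumpZero r l) (pc, R) = (if R r = 0 then l else Suc pc, R)"

definition halted :: "program \<Rightarrow> config \<Rightarrow> bool" where
  "halted P s \<longleftrightarrow> length P \<le> fst s"

definition step :: "program \<Rightarrow> bool list \<Rightarrow> config \<Rightarrow> config" where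
  "step P w s = (if halted P s then s else exec w (P ! fst s) s)"

definition run :: "program \<Rightarrow> bool list \<Rightarrow> nat \<Rightarrow> config" where
  "run P w t = (step P w ^^ t) (0, \<lambda>_. 0)"

text \<open>On termination, register 0 holds the answer. A decision problem restricted to a class of
  instances imposes no requirement on inputs that do not encode an instance of that class.\<close>

definition poly_time_solvable ::
    "('i \<Rightarrow> bool list) \<Rightarrow> 'i set \<Rightarrow> ('i \<Rightarrow> bool) \<Rightarrow> bool" where
  "poly_time_solvable enc I yes \<longleftrightarrow>
     (\<exists>(P :: program) (p :: nat poly). \<forall>x\<in>I.
        \<exists>t \<le> poly p (length (enc x)).
          halted P (run P (enc x) t) \<and>
          snd (run P (enc x) t) 0 = of_bool (yes x))"

end

theory Submission
  imports Defs
begin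

text \<open>Call an edge \<open>uv\<close> with \<open>u < v\<close> together with \<open>k\<close> vertices before \<open>u\<close>, \<open>k\<close> vertices between
  \<open>u\<close> and \<open>v\<close> and \<open>k\<close> vertices after \<open>v\<close> a pattern if \<open>uv\<close> is the only edge among these vertices. An
  ordered graph \<open>H\<close> with at most one edge is an induced subgraph of the pattern as soon as \<open>k\<close> is at
  least its number of vertices (\<open>pattern_embedding\<close>), so an \<open>H\<close>-free ordered graph contains no
  pattern.

  Without a pattern, independence of a vertex set \<open>A\<close> is a local property: it suffices that no vertex
  of \<open>A\<close> has a neighbour among the first \<open>k\<close> vertices of \<open>A\<close>, among the last \<open>k\<close> vertices of \<open>A\<close>, or
  among the \<open>k\<close> vertices of \<open>A\<close> that directly precede it. For suppose that \<open>A\<close> still contains an edge,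
  and take an edge \<open>uv\<close> with as few vertices of \<open>A\<close> between its ends as possible. At least \<open>k\<close> vertices
  of \<open>A\<close> lie before \<open>u\<close>, between \<open>u\<close> and \<open>v\<close>, and after \<open>v\<close>; the first and the last \<open>k\<close> vertices of
  \<open>A\<close> are isolated in \<open>A\<close>, and by minimality the vertices from \<open>u\<close> to \<open>v\<close> span no edge other than
  \<open>uv\<close>. This is a pattern (\<open>independent_if_locally_independent\<close>).

  Hence the vertices can be coloured one by one in increasing order, remembering for each of the three
  colours only the first \<open>k\<close> and the latest \<open>k\<close> vertices that received it, and a guess, made at the
  start and verified at the end, of the last \<open>k\<close> vertices that will receive it. As \<open>k\<close> is a constant,
  there are polynomially many such states. They are coded by numbers so that every transition
  increases the code, and a graph is colourable iff an accepting state is reachable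
  (\<open>reachable_iff\<close>, \<open>colorable_iff_reachable\<close>).

  The random access machine decides reachability by filling a table in the order of the codes. To keep
  programs out of the argument, one compiler is verified for arithmetic expressions with bounded sums
  that may read the input and the table (\<open>compile_runs\<close>). All variables of such an expression
  are bounded by a polynomial, so its evaluation takes polynomial time even by brute force, and
  recursion along the table is polynomial-time as soon as each entry is given by an expression over the
  earlier ones (\<open>poly_time_by_table\<close>). Products, quotients, comparisons and bounded quantifiers are
  such expressions, which makes the transitions of the colouring procedure expressible.\<close>

section \<open>Executing program fragments\<close>

text \<open>Jump targets are absolute, so a fragment of code is a function of the address at which it is
  placed.\<close>

type_synonym fragment = "nat \<Rightarrow> instr list"

text \<open>The surrounding program is arbitrary, which makes fragments composable: control enters at the first
  instruction and leaves to the one right behind the fragment.\<close>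
definition runs :: "bool list \<Rightarrow> fragment \<Rightarrow> (nat \<Rightarrow> nat) \<Rightarrow> nat \<Rightarrow> (nat \<Rightarrow> nat) \<Rightarrow> bool" where
  "runs w c R T R' \<longleftrightarrow> (\<forall>pre post. \<exists>t\<le>T.
     (step (pre @ c (length pre) @ post) w ^^ t) (length pre, R) =
       (length pre + length (c (length pre)), R'))"

definition instrs :: "instr list \<Rightarrow> fragment" where
  "instrs ins = (\<lambda>a. ins)"

definition seq :: "fragment \<Rightarrow> fragment \<Rightarrow> fragment" where
  "seq c d = (\<lambda>a. c a @ d (a + length (c a)))"

text \<open>There is no unconditional jump, so the jump back clears register 0 and tests it. Register 0 is
  therefore scratch space throughout: no invariant may speak about it across an iteration.\<close>
definition while_nz :: "nat \<Rightarrow> fragment \<Rightarrow> fragment" where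
  "while_nz r c = (\<lambda>a. JumpZero r (a + length (c (Suc a)) + 3) # c (Suc a) @ [Const 0 0, JumpZero 0 a])"

fun no_jump :: "instr \<Rightarrow> bool" where
  "no_jump (JumpZero r l) = False"
| "no_jump _ = True"

definition effect :: "bool list \<Rightarrow> instr \<Rightarrow> (nat \<Rightarrow> nat) \<Rightarrow> (nat \<Rightarrow> nat)" where
  "effect w i R = snd (exec w i (0, R))"

lemma exec_no_jump: "no_jump i \<Longrightarrow> exec w i (pc, R) = (Suc pc, effect w i R)"
  by (cases i) (auto simp: effect_def)

lemma effect_simps [simp]:
  "effect w (Const r k) R = R(r := k)"
  "effect w (Add r i j) R = R(r := R i + R j)"
  "effect w (Sub r i j) R = R(r := R i - R j)"
  "effect w (Load r i) R = R(r := R (R i))"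
  "effect w (Store i r) R = R(R i := R r)"
  "effect w (Read r i) R = R(r := of_bool (R i < length w \<and> w ! R i))"
  by (auto simp: effect_def)

lemma step_at:
  "step (pre @ i # post) w (length pre, R) = exec w i (length pre, R)"
  by (simp add: step_def halted_def)

lemma runs_mono: "runs w c R T R' \<Longrightarrow> T \<le> T' \<Longrightarrow> runs w c R T' R'"
  unfolding runs_def by (meson le_trans)

lemma runs_seq:
  assumes "runs w c R T1 R1" and "runs w d R1 T2 R2"
  shows "runs w (seq c d) R (T1 + T2) R2"
  unfolding runs_def
proof (intro allI)
  fix pre post :: "instr list"
  let ?c = "c (length pre)"
  let ?d = "d (length pre + length ?c)"
  let ?P = "pre @ ?c @ ?d @ post"
  obtain t1 where t1: "t1 \<le> T1" "(step ?P w ^^ t1) (length pre, R) = (length pre + length ?c, R1)"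
    using assms(1) unfolding runs_def by blast
  obtain t2 where t2: "t2 \<le> T2" "(step ((pre @ ?c) @ ?d @ post) w ^^ t2) (length (pre @ ?c), R1)
      = (length (pre @ ?c) + length ?d, R2)"
    using assms(2) unfolding runs_def by (metis length_append)
  have "(step ?P w ^^ (t2 + t1)) (length pre, R) = (length pre + length (?c @ ?d), R2)"
    using t1(2) t2(2) by (simp add: funpow_add add.assoc)
  then show "\<exists>t\<le>T1 + T2. (step (pre @ seq c d (length pre) @ post) w ^^ t) (length pre, R) =
      (length pre + length (seq c d (length pre)), R2)"
    using t1(1) t2(1) unfolding seq_def by (intro exI[of _ "t2 + t1"]) auto
qed

lemma runs_instrs:
  assumes "\<forall>i\<in>set ins. no_jump i"
  shows "runs w (instrs ins) R (length ins) (fold (effect w) ins R)"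
  using assms
proof (induction ins arbitrary: R)
  case Nil
  then show ?case by (auto simp: runs_def instrs_def)
next
  case (Cons i ins)
  have "runs w (instrs [i]) R 1 (effect w i R)"
    using Cons.prems unfolding runs_def instrs_def
    by (auto intro!: exI[of _ 1] simp: step_at exec_no_jump)
  moreover have "runs w (instrs ins) (effect w i R) (length ins) (fold (effect w) ins (effect w i R))"
    using Cons by simp
  ultimately have "runs w (seq (instrs [i]) (instrs ins)) R (1 + length ins)
      (fold (effect w) ins (effect w i R))"
    by (rule runs_seq)
  then show ?case by (simp add: seq_def instrs_def)
qed

lemma runs_while_exit:
  assumes "R r = 0"
  shows "runs w (while_nz r c) R 1 R"
  using assms unfolding runs_def while_nz_def
  by (auto intro!: exI[of _ 1] simp: step_at)

lemma runs_while_step: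
  assumes "R r \<noteq> 0" and "runs w c R T1 R1" and "runs w (while_nz r c) (R1(0 := 0)) T2 R2"
  shows "runs w (while_nz r c) R (T1 + 3 + T2) R2"
  unfolding runs_def
proof (intro allI)
  fix pre post :: "instr list"
  let ?a = "length pre"
  let ?c = "c (Suc ?a)"
  let ?j = "JumpZero r (?a + length ?c + 3)"
  let ?W = "while_nz r c ?a"
  let ?P = "pre @ ?W @ post"
  have W: "?W = ?j # ?c @ [Const 0 0, JumpZero 0 ?a]"
    by (simp add: while_nz_def)
  have s1: "step ?P w (?a, R) = (Suc ?a, R)"
    using assms(1) by (simp add: W step_at)
  obtain t1 where t1: "t1 \<le> T1"
    "(step ((pre @ [?j]) @ ?c @ [Const 0 0, JumpZero 0 ?a] @ post) w ^^ t1) (Suc ?a, R)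
       = (Suc ?a + length ?c, R1)"
    using assms(2)[unfolded runs_def, rule_format,
      of "pre @ [?j]" "[Const 0 0, JumpZero 0 ?a] @ post"] by auto
  then have s2: "(step ?P w ^^ t1) (Suc ?a, R) = (Suc ?a + length ?c, R1)"
    by (simp add: W)
  have "step ((pre @ ?j # ?c) @ Const 0 0 # JumpZero 0 ?a # post) w (length (pre @ ?j # ?c), R1)
      = (Suc (length (pre @ ?j # ?c)), R1(0 := 0))"
    by (subst step_at) simp
  then have s3: "step ?P w (Suc ?a + length ?c, R1) = (Suc (Suc ?a + length ?c), R1(0 := 0))"
    by (simp add: W)
  have "step ((pre @ ?j # ?c @ [Const 0 0]) @ JumpZero 0 ?a # post) w
      (length (pre @ ?j # ?c @ [Const 0 0]), R1(0 := 0)) = (?a, R1(0 := 0))"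
    by (subst step_at) simp
  then have s4: "step ?P w (Suc (Suc ?a + length ?c), R1(0 := 0)) = (?a, R1(0 := 0))"
    by (simp add: W)
  obtain t2 where t2: "t2 \<le> T2"
    "(step ?P w ^^ t2) (?a, R1(0 := 0)) = (?a + length ?W, R2)"
    using assms(3) unfolding runs_def by blast
  have one: "(step ?P w ^^ 1) s = step ?P w s" for s
    by simp
  have "(step ?P w ^^ (t2 + (1 + (1 + (t1 + 1))))) (?a, R) = (?a + length ?W, R2)"
    by (simp only: funpow_add o_apply one s1 s2 s3 s4 t2(2))
  then show "\<exists>t\<le>T1 + 3 + T2. (step ?P w ^^ t) (?a, R) = (?a + length ?W, R2)"
    using t1(1) t2(1) by (intro exI[of _ "t2 + (1 + (1 + (t1 + 1)))"]) auto
qed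

text \<open>All loops make a number of iterations that is known in advance, so the invariant is indexed by the
  iterations made. It has to survive the clearing of register 0 by the jump back.\<close>
lemma runs_while:
  assumes step: "\<And>i R. i < N \<Longrightarrow> Inv i R \<Longrightarrow>
      R r \<noteq> 0 \<and> (\<exists>R'. runs w c R T R' \<and> Inv (Suc i) (R'(0 := 0)))"
    and exit: "\<And>R. Inv N R \<Longrightarrow> R r = 0"
    and start: "Inv 0 R"
  shows "\<exists>R'. runs w (while_nz r c) R (N * (T + 3) + 1) R' \<and> Inv N R'"
proof -
  have "i \<le> N \<Longrightarrow> Inv i R \<Longrightarrow>
      \<exists>R'. runs w (while_nz r c) R ((N - i) * (T + 3) + 1) R' \<and> Inv N R'" for i R
  proof (induction "N - i" arbitrary: i R)
    case 0
    then have "i = N" by simp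
    with 0 have "runs w (while_nz r c) R ((N - i) * (T + 3) + 1) R \<and> Inv N R"
      using runs_while_exit[of R r w c] exit by simp
    then show ?case by blast
  next
    case (Suc k)
    then have "i < N" and le: "Suc i \<le> N" and k: "k = N - Suc i" by simp_all
    with Suc.prems step obtain R1 where R1: "R r \<noteq> 0" "runs w c R T R1" "Inv (Suc i) (R1(0 := 0))"
      by blast
    obtain R2 where R2: "runs w (while_nz r c) (R1(0 := 0)) ((N - Suc i) * (T + 3) + 1) R2"
      "Inv N R2"
      using Suc.hyps(1)[OF k le R1(3)] by blast
    have "T + 3 + ((N - Suc i) * (T + 3) + 1) = (N - i) * (T + 3) + 1"
      using \<open>i < N\<close> by (simp add: Suc_diff_Suc[symmetric])
    then show ?case using runs_while_step[OF R1(1,2) R2(1)] R2(2) by metis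
  qed
  from this[of 0 R] show ?thesis using start by simp
qed

section \<open>Compiling arithmetic expressions\<close>

text \<open>\<open>Bit\<close> reads the input and \<open>Tab\<close> the table. \<open>Sum x e f\<close> sums \<open>f\<close> over the values of the variable \<open>x\<close>
  below \<open>e\<close>; it is the only iteration, and its range is fixed before it starts.\<close>
datatype expr =
    Num nat
  | Var nat
  | Plus expr expr
  | Minus expr expr
  | Bit expr
  | Tab expr
  | Sum nat expr expr

fun eval :: "bool list \<Rightarrow> (nat \<Rightarrow> nat) \<Rightarrow> (nat \<Rightarrow> nat) \<Rightarrow> expr \<Rightarrow> nat" where
  "eval w A v (Num k) = k"
| "eval w A v (Var x) = v x"
| "eval w A v (Plus e f) = eval w A v e + eval w A v f"
| "eval w A v (Minus e f) = eval w A v e - eval w A v f"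
| "eval w A v (Bit e) = of_bool (eval w A v e < length w \<and> w ! eval w A v e)"
| "eval w A v (Tab e) = A (eval w A v e)"
| "eval w A v (Sum x e f) = (\<Sum>i<eval w A v e. eval w A (v(x := i)) f)"

text \<open>A strict upper bound on the indices of all variables that occur, bound ones included.\<close>
fun width :: "expr \<Rightarrow> nat" where
  "width (Num k) = 0"
| "width (Var x) = Suc x"
| "width (Plus e f) = max (width e) (width f)"
| "width (Minus e f) = max (width e) (width f)"
| "width (Bit e) = width e"
| "width (Tab e) = width e"
| "width (Sum x e f) = max (Suc x) (max (width e) (width f))"

lemma eval_cong:
  "(\<And>x. x < width e \<Longrightarrow> v x = v' x) \<Longrightarrow> eval w A v e = eval w A v' e"
proof (induction e arbitrary: v v')
  case (Plus e f)
  have "eval w A v e = eval w A v' e" "eval w A v f = eval w A v' f"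
    by (rule Plus.IH; simp add: Plus.prems)+
  then show ?case by simp
next
  case (Minus e f)
  have "eval w A v e = eval w A v' e" "eval w A v f = eval w A v' f"
    by (rule Minus.IH; simp add: Minus.prems)+
  then show ?case by simp
next
  case (Bit e)
  from Bit.IH[OF Bit.prems] show ?case by simp
next
  case (Tab e)
  from Tab.IH[OF Tab.prems] show ?case by simp
next
  case (Sum x e f)
  have "eval w A v e = eval w A v' e"
    by (rule Sum.IH(1)) (simp add: Sum.prems)
  moreover have "eval w A (v(x := i)) f = eval w A (v'(x := i)) f" for i
    by (rule Sum.IH(2)) (simp add: Sum.prems)
  ultimately show ?case by simp
qed auto

text \<open>The registers that the evaluation occupies, the one for the result included.\<close>
fun room :: "expr \<Rightarrow> nat" where
  "room (Num k) = 1"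
| "room (Var x) = 1"
| "room (Plus e f) = Suc (room e + room f)"
| "room (Minus e f) = Suc (room e + room f)"
| "room (Bit e) = room e"
| "room (Tab e) = room e"
| "room (Sum x e f) = 3 + room e + room f"

text \<open>The variable \<open>x\<close> lives in register \<open>Suc x\<close>, the table in the registers from \<open>K\<close> on. The value is
  computed into register \<open>d\<close>, which lies above all variables; registers between \<open>d\<close> and \<open>K\<close> are free
  for intermediate results. A sum counts register \<open>d\<close> down, keeps the old value of its variable in
  register \<open>d + 1\<close> to restore it, and accumulates in register \<open>d + 2\<close>.\<close>
fun compile :: "nat \<Rightarrow> expr \<Rightarrow> nat \<Rightarrow> fragment" where
  "compile K (Num k) d = instrs [Const d k]"
| "compile K (Var x) d = instrs [Const 0 0, Add d (Suc x) 0]"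
| "compile K (Plus e f) d = seq (compile K e d) (seq (compile K f (d + 1)) (instrs [Add d d (d + 1)]))"
| "compile K (Minus e f) d = seq (compile K e d) (seq (compile K f (d + 1)) (instrs [Sub d d (d + 1)]))"
| "compile K (Bit e) d = seq (compile K e d) (instrs [Read d d])"
| "compile K (Tab e) d = seq (compile K e d) (instrs [Const 0 K, Add 0 0 d, Load d 0])"
| "compile K (Sum x e f) d =
     seq (compile K e d)
    (seq (instrs [Const 0 0, Add (d + 1) (Suc x) 0, Const (d + 2) 0, Const (Suc x) 0])
    (seq (while_nz d (seq (compile K f (d + 3))
            (instrs [Add (d + 2) (d + 2) (d + 3), Const 0 1, Add (Suc x) (Suc x) 0, Sub d d 0])))
         (instrs [Const 0 0, Add (Suc x) (d + 1) 0, Add d (d + 2) 0])))"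

text \<open>If all variables and table entries are at most \<open>m\<close>, the bound variable of a sum is at most the value of
  its range, so that \<open>m\<close> plus a bound on the range bounds all variables of its body.\<close>
fun val_bound :: "expr \<Rightarrow> nat \<Rightarrow> nat" where
  "val_bound (Num k) m = k"
| "val_bound (Var x) m = m"
| "val_bound (Plus e f) m = val_bound e m + val_bound f m"
| "val_bound (Minus e f) m = val_bound e m"
| "val_bound (Bit e) m = 1"
| "val_bound (Tab e) m = m"
| "val_bound (Sum x e f) m = val_bound e m * val_bound f (m + val_bound e m)"

lemma eval_le_val_bound:
  assumes "\<And>x. x < width e \<Longrightarrow> v x \<le> m" and "\<And>s. A s \<le> m"
  shows "eval w A v e \<le> val_bound e m"
  using assms
proof (induction e arbitrary: v m)
  case (Plus e f)
  have "eval w A v e \<le> val_bound e m" "eval w A v f \<le> val_bound f m"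
    by (rule Plus.IH; simp add: Plus.prems)+
  then show ?case by simp
next
  case (Minus e f)
  have "eval w A v e \<le> val_bound e m"
    by (rule Minus.IH; simp add: Minus.prems)
  then show ?case by simp
next
  case (Sum x e f)
  have e: "eval w A v e \<le> val_bound e m"
    by (rule Sum.IH(1); simp add: Sum.prems)
  have "eval w A (v(x := i)) f \<le> val_bound f (m + val_bound e m)" if "i < eval w A v e" for i
  proof (rule Sum.IH(2))
    show "(v(x := i)) y \<le> m + val_bound e m" if "y < width f" for y
      using Sum.prems(1)[of y] that e \<open>i < eval w A v e\<close> by (cases "y = x") (auto simp: trans_le_add1)
    show "A s \<le> m + val_bound e m" for s
      using Sum.prems(2)[of s] by simp
  qed
  then have "(\<Sum>i<eval w A v e. eval w A (v(x := i)) f)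
      \<le> of_nat (card {..<eval w A v e}) * val_bound f (m + val_bound e m)"
    by (intro sum_bounded_above) auto
  also have "\<dots> \<le> val_bound e m * val_bound f (m + val_bound e m)"
    using e by simp
  finally show ?case by simp
qed auto

text \<open>In a sum, each iteration takes four instructions besides its body and three steps of loop control; the
  remaining eight steps prepare the loop, leave it and restore the variable.\<close>
fun cost :: "expr \<Rightarrow> nat \<Rightarrow> nat" where
  "cost (Num k) m = 1"
| "cost (Var x) m = 2"
| "cost (Plus e f) m = cost e m + cost f m + 1"
| "cost (Minus e f) m = cost e m + cost f m + 1"
| "cost (Bit e) m = cost e m + 1"
| "cost (Tab e) m = cost e m + 3"
| "cost (Sum x e f) m = cost e m + val_bound e m * (cost f (m + val_bound e m) + 7) + 8"

text \<open>Exactly the registers that carry variables, enclosing intermediate results or the table are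
  guaranteed to survive.\<close>
definition yields :: "nat \<Rightarrow> nat \<Rightarrow> (nat \<Rightarrow> nat) \<Rightarrow> nat \<Rightarrow> (nat \<Rightarrow> nat) \<Rightarrow> bool" where
  "yields K d R y R' \<longleftrightarrow> R' d = y \<and> (\<forall>r. 0 < r \<longrightarrow> r < d \<or> K \<le> r \<longrightarrow> R' r = R r)"

abbreviation (input) vars_of :: "(nat \<Rightarrow> nat) \<Rightarrow> nat \<Rightarrow> nat" where
  "vars_of R \<equiv> \<lambda>x. R (Suc x)"

abbreviation (input) table_of :: "nat \<Rightarrow> (nat \<Rightarrow> nat) \<Rightarrow> nat \<Rightarrow> nat" where
  "table_of K R \<equiv> \<lambda>s. R (K + s)"

lemma eval_frame:
  assumes "\<forall>r. 0 < r \<longrightarrow> r < d \<or> K \<le> r \<longrightarrow> R' r = R r" and "width e < d" and "0 < K"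
  shows "eval w (table_of K R') (vars_of R') e = eval w (table_of K R) (vars_of R) e"
proof -
  have "table_of K R' = table_of K R" using assms by auto
  then show ?thesis using assms by (auto intro!: eval_cong)
qed

lemma room_pos: "0 < room e"
  by (induction e) auto

text \<open>Correctness and cost of compiled expressions. The variable and table registers serve as the
  environment, so that the induction hypothesis applies to the registers that an earlier part leaves
  behind as soon as these agree on the variables and the table.\<close>
lemma compile_runs:
  assumes "width e < d" and "d + room e \<le> K"
    and "\<And>x. x < width e \<Longrightarrow> R (Suc x) \<le> m" and "\<And>s. R (K + s) \<le> m"
  shows "\<exists>R'. runs w (compile K e d) R (cost e m) R' \<and>
      yields K d R (eval w (table_of K R) (vars_of R) e) R'"
  using assms
proof (induction e arbitrary: d R m)
  case (Num k)
  have "runs w (compile K (Num k) d) R (cost (Num k) m) (R(d := k))"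
    using runs_instrs[of "[Const d k]" w R] by simp
  moreover have "yields K d R k (R(d := k))"
    using Num.prems(2) by (auto simp: yields_def)
  ultimately show ?case by auto
next
  case (Var x)
  let ?R = "(R(0 := 0))(d := (R(0 := 0)) (Suc x) + (R(0 := 0)) 0)"
  have "runs w (compile K (Var x) d) R (cost (Var x) m) ?R"
    using runs_instrs[of "[Const 0 0, Add d (Suc x) 0]" w R]
    by (simp del: fun_upd_apply add: numeral_2_eq_2)
  moreover have "yields K d R (R (Suc x)) ?R"
    using Var.prems(2) by (auto simp: yields_def)
  ultimately show ?case by (metis eval.simps(2))
next
  case (Plus e f)
  let ?y = "eval w (table_of K R) (vars_of R) e" and ?z = "eval w (table_of K R) (vars_of R) f"
  have we: "width e < d" and wf: "width f < d" and K: "d + room e \<le> K" "d + 1 + room f \<le> K" "0 < K"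
    using Plus.prems(1,2) by auto
  obtain R1 where R1: "runs w (compile K e d) R (cost e m) R1" "yields K d R ?y R1"
    using Plus.IH(1)[OF we K(1)] Plus.prems(3,4) by (metis less_max_iff_disj width.simps(3))
  have fr: "\<forall>r. 0 < r \<longrightarrow> r < d \<or> K \<le> r \<longrightarrow> R1 r = R r"
    using R1(2) by (simp add: yields_def)
  have v: "R1 (Suc x) \<le> m" if "x < width f" for x
    using Plus.prems(3)[of x] fr wf that by simp
  have A: "R1 (K + s) \<le> m" for s
    using Plus.prems(4)[of s] fr K(3) by simp
  have wf': "width f < d + 1" using wf by simp
  obtain R2 where R2: "runs w (compile K f (d + 1)) R1 (cost f m) R2" "yields K (d + 1) R1 ?z R2"
    using Plus.IH(2)[OF wf' K(2) v A] eval_frame[OF fr wf K(3)] by auto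
  let ?R = "R2(d := R2 d + R2 (d + 1))"
  have "runs w (compile K (Plus e f) d) R (cost e m + (cost f m + 1)) ?R"
    unfolding compile.simps using runs_instrs[of "[Add d d (d + 1)]" w R2]
    by (intro runs_seq[OF R1(1)] runs_seq[OF R2(1)]) simp
  moreover have "yields K d R (?y + ?z) ?R"
    unfolding yields_def
  proof (intro conjI allI impI)
    show "?R d = ?y + ?z"
      using R1(2) R2(2) we by (simp add: yields_def)
    show "?R r = R r" if "0 < r" "r < d \<or> K \<le> r" for r
      using R2(2) fr that K(2) by (auto simp: yields_def)
  qed
  ultimately show ?case by (auto simp: add.assoc)
next
  case (Minus e f)
  let ?y = "eval w (table_of K R) (vars_of R) e" and ?z = "eval w (table_of K R) (vars_of R) f"
  have we: "width e < d" and wf: "width f < d" and K: "d + room e \<le> K" "d + 1 + room f \<le> K" "0 < K"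
    using Minus.prems(1,2) by auto
  obtain R1 where R1: "runs w (compile K e d) R (cost e m) R1" "yields K d R ?y R1"
    using Minus.IH(1)[OF we K(1)] Minus.prems(3,4) by (metis less_max_iff_disj width.simps(4))
  have fr: "\<forall>r. 0 < r \<longrightarrow> r < d \<or> K \<le> r \<longrightarrow> R1 r = R r"
    using R1(2) by (simp add: yields_def)
  have v: "R1 (Suc x) \<le> m" if "x < width f" for x
    using Minus.prems(3)[of x] fr wf that by simp
  have A: "R1 (K + s) \<le> m" for s
    using Minus.prems(4)[of s] fr K(3) by simp
  have wf': "width f < d + 1" using wf by simp
  obtain R2 where R2: "runs w (compile K f (d + 1)) R1 (cost f m) R2" "yields K (d + 1) R1 ?z R2"
    using Minus.IH(2)[OF wf' K(2) v A] eval_frame[OF fr wf K(3)] by auto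
  let ?R = "R2(d := R2 d - R2 (d + 1))"
  have "runs w (compile K (Minus e f) d) R (cost e m + (cost f m + 1)) ?R"
    unfolding compile.simps using runs_instrs[of "[Sub d d (d + 1)]" w R2]
    by (intro runs_seq[OF R1(1)] runs_seq[OF R2(1)]) simp
  moreover have "yields K d R (?y - ?z) ?R"
    unfolding yields_def
  proof (intro conjI allI impI)
    show "?R d = ?y - ?z"
      using R1(2) R2(2) we by (simp add: yields_def)
    show "?R r = R r" if "0 < r" "r < d \<or> K \<le> r" for r
      using R2(2) fr that K(2) by (auto simp: yields_def)
  qed
  ultimately show ?case by (auto simp: add.assoc)
next
  case (Bit e)
  have we: "width e < d" and K: "d + room e \<le> K" "d < K"
    using Bit.prems(1,2) room_pos[of e] by auto
  obtain R1 where R1: "runs w (compile K e d) R (cost e m) R1"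
    "yields K d R (eval w (table_of K R) (vars_of R) e) R1"
    using Bit.IH[OF we K(1)] Bit.prems(3,4) by (metis width.simps(5))
  let ?ins = "[Read d d]"
  let ?R = "fold (effect w) ?ins R1"
  have "runs w (compile K (Bit e) d) R (cost e m + 1) ?R"
    unfolding compile.simps using runs_instrs[of ?ins w R1]
    by (intro runs_seq[OF R1(1)]) (simp del: fun_upd_apply add: numeral_eq_Suc)
  moreover have "yields K d R (eval w (table_of K R) (vars_of R) (Bit e)) ?R"
    using R1(2) K(2) we by (auto simp: yields_def)
  ultimately show ?case by auto
next
  case (Tab e)
  have we: "width e < d" and K: "d + room e \<le> K" "d < K"
    using Tab.prems(1,2) room_pos[of e] by auto
  obtain R1 where R1: "runs w (compile K e d) R (cost e m) R1"
    "yields K d R (eval w (table_of K R) (vars_of R) e) R1"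
    using Tab.IH[OF we K(1)] Tab.prems(3,4) by (metis width.simps(6))
  let ?ins = "[Const 0 K, Add 0 0 d, Load d 0]"
  let ?R = "fold (effect w) ?ins R1"
  have "runs w (compile K (Tab e) d) R (cost e m + 3) ?R"
    unfolding compile.simps using runs_instrs[of ?ins w R1]
    by (intro runs_seq[OF R1(1)]) (simp del: fun_upd_apply add: numeral_eq_Suc)
  moreover have "yields K d R (eval w (table_of K R) (vars_of R) (Tab e)) ?R"
    using R1(2) K(2) we by (auto simp: yields_def)
  ultimately show ?case by auto
next
  case (Sum x e f)
  let ?A = "table_of K R" and ?v = "vars_of R"
  define N where "N = eval w ?A ?v e"
  define m' where "m' = m + val_bound e m"
  define g where "g i = eval w ?A (?v(x := i)) f" for i
  have we: "width e < d" and wf: "width f < d + 3" and x: "Suc x < d"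
    and K: "d + room e \<le> K" "d + 3 + room f \<le> K" "d + 3 < K"
    using Sum.prems(1,2) room_pos[of f] by auto
  have me: "R (Suc y) \<le> m" if "y < width e" for y
    using Sum.prems(3)[of y] that by simp
  obtain R1 where R1: "runs w (compile K e d) R (cost e m) R1" "yields K d R N R1"
    using Sum.IH(1)[OF we K(1) me Sum.prems(4)] unfolding N_def by blast
  have N: "N \<le> val_bound e m"
    unfolding N_def using me Sum.prems(4) by (rule eval_le_val_bound)
  let ?prep = "[Const 0 0, Add (d + 1) (Suc x) 0, Const (d + 2) 0, Const (Suc x) 0]"
  let ?upd = "[Add (d + 2) (d + 2) (d + 3), Const 0 1, Add (Suc x) (Suc x) 0, Sub d d 0]"
  let ?post = "[Const 0 0, Add (Suc x) (d + 1) 0, Add d (d + 2) 0]"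
  define R2 where "R2 = fold (effect w) ?prep R1"
  define Inv where "Inv i S \<longleftrightarrow> S d = N - i \<and> S (d + 1) = R (Suc x) \<and> S (d + 2) = (\<Sum>j<i. g j) \<and>
      S (Suc x) = i \<and> (\<forall>r. 0 < r \<longrightarrow> r \<noteq> Suc x \<longrightarrow> r < d \<or> K \<le> r \<longrightarrow> S r = R r)"
    for i and S :: "nat \<Rightarrow> nat"
  have "\<exists>R3. runs w (while_nz d (seq (compile K f (d + 3)) (instrs ?upd))) R2
      (N * ((cost f m' + 4) + 3) + 1) R3 \<and> Inv N R3"
  proof (rule runs_while)
    fix i S
    assume i: "i < N" and S: "Inv i S"
    have fr: "S r = R r" if "0 < r" "r \<noteq> Suc x" "r < d \<or> K \<le> r" for r
      using S that unfolding Inv_def by blast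
    have v: "S (Suc y) \<le> m'" if "y < width f" for y
    proof (cases "y = x")
      case True
      then show ?thesis using S i N by (simp add: Inv_def m'_def)
    next
      case False
      then show ?thesis
        using Sum.prems(1) Sum.prems(3)[of y] fr[of "Suc y"] that by (simp add: m'_def trans_le_add1)
    qed
    have A: "S (K + s) = R (K + s)" for s
      using K(3) x by (intro fr) auto
    have "S (K + s) \<le> m'" for s
      using Sum.prems(4)[of s] A by (simp add: m'_def trans_le_add1)
    then obtain S1 where S1: "runs w (compile K f (d + 3)) S (cost f m') S1"
      "yields K (d + 3) S (eval w (table_of K S) (vars_of S) f) S1"
      using Sum.IH(2)[of "d + 3" S m', OF wf K(2) v] by blast
    have "eval w (table_of K S) (vars_of S) f = eval w ?A (vars_of S) f"
      by (simp only: A)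
    also have "\<dots> = g i"
      unfolding g_def
    proof (rule eval_cong)
      fix y assume "y < width f"
      then show "vars_of S y = (?v(x := i)) y"
        using S fr[of "Suc y"] Sum.prems(1) by (cases "y = x") (simp_all add: Inv_def)
    qed
    finally have y: "S1 (d + 3) = g i" using S1(2) by (simp add: yields_def)
    let ?S = "fold (effect w) ?upd S1"
    have "runs w (seq (compile K f (d + 3)) (instrs ?upd)) S (cost f m' + 4) ?S"
      using runs_instrs[of ?upd w S1]
      by (intro runs_seq[OF S1(1)]) (simp del: fun_upd_apply add: numeral_eq_Suc)
    moreover have "Inv (Suc i) (?S(0 := 0))"
    proof -
      have S1r: "S1 r = S r" if "0 < r" "r < d + 3 \<or> K \<le> r" for r
        using S1(2) that unfolding yields_def by blast
      show ?thesis
        using S S1r y i x K(3) unfolding Inv_def by simp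
    qed
    moreover have "S d \<noteq> 0"
      using S i by (simp add: Inv_def)
    ultimately show "S d \<noteq> 0 \<and> (\<exists>R'. runs w (seq (compile K f (d + 3)) (instrs ?upd)) S (cost f m' + 4) R'
        \<and> Inv (Suc i) (R'(0 := 0)))"
      by blast
  next
    show "S d = 0" if "Inv N S" for S
      using that by (simp add: Inv_def)
    have "R1 r = R r" if "0 < r" "r < d \<or> K \<le> r" for r
      using R1(2) that unfolding yields_def by blast
    then show "Inv 0 R2"
      using R1(2) x K(3) by (simp add: Inv_def R2_def yields_def)
  qed
  then obtain R3 where R3: "runs w (while_nz d (seq (compile K f (d + 3)) (instrs ?upd))) R2
      (N * ((cost f m' + 4) + 3) + 1) R3" "Inv N R3"
    by blast
  let ?R = "fold (effect w) ?post R3"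
  have prep: "runs w (instrs ?prep) R1 4 R2"
    using runs_instrs[of ?prep w R1] unfolding R2_def
    by (simp del: fun_upd_apply fold_simps add: numeral_eq_Suc)
  have post: "runs w (instrs ?post) R3 3 ?R"
    using runs_instrs[of ?post w R3]
    by (simp del: fun_upd_apply fold_simps add: numeral_eq_Suc)
  have "runs w (compile K (Sum x e f) d) R
      (cost e m + (4 + (N * ((cost f m' + 4) + 3) + 1 + 3))) ?R"
    unfolding compile.simps
    by (rule runs_seq[OF R1(1) runs_seq[OF prep runs_seq[OF R3(1) post]]])
  moreover have "cost e m + (4 + (N * ((cost f m' + 4) + 3) + 1 + 3)) \<le> cost (Sum x e f) m"
  proof -
    have "N * (cost f m' + 7) \<le> val_bound e m * (cost f m' + 7)"
      using N by (rule mult_le_mono1)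
    then show ?thesis by (simp add: m'_def add.assoc)
  qed
  moreover have "yields K d R (\<Sum>i<N. g i) ?R"
    using R3(2) x K(3) by (auto simp: Inv_def yields_def)
  ultimately have "runs w (compile K (Sum x e f) d) R (cost (Sum x e f) m) ?R \<and>
      yields K d R (eval w (table_of K R) (vars_of R) (Sum x e f)) ?R"
    unfolding eval.simps N_def g_def by (blast intro: runs_mono)
  then show ?case by blast
qed

section \<open>Functions given by expressions\<close>

text \<open>Closure properties of this notion replace the construction of concrete expressions: below, a function
  is shown definable by following the shape of its definition.\<close>
definition definable :: "(bool list \<Rightarrow> (nat \<Rightarrow> nat) \<Rightarrow> (nat \<Rightarrow> nat) \<Rightarrow> nat) \<Rightarrow> bool" where
  "definable F \<longleftrightarrow> (\<exists>e. \<forall>w A v. F w A v = eval w A v e)"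

lemma definableI: "(\<And>w A v. F w A v = eval w A v e) \<Longrightarrow> definable F"
  by (auto simp: definable_def)

lemma definable_cong:
  assumes "definable F" and "\<And>w A v. F w A v = G w A v"
  shows "definable G"
proof -
  have "F = G" by (intro ext) (rule assms(2))
  then show ?thesis using assms(1) by simp
qed

lemma definable_const: "definable (\<lambda>w A v. k)"
  by (rule definableI[of _ "Num k"]) simp

lemma definable_var: "definable (\<lambda>w A v. v x)"
  by (rule definableI[of _ "Var x"]) simp

lemma definable_plus:
  assumes "definable F" and "definable G"
  shows "definable (\<lambda>w A v. F w A v + G w A v)"
  using assms unfolding definable_def by (metis eval.simps(3))

lemma definable_minus:
  assumes "definable F" and "definable G"
  shows "definable (\<lambda>w A v. F w A v - G w A v)"
  using assms unfolding definable_def by (metis eval.simps(4))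

lemma definable_bit:
  assumes "definable F"
  shows "definable (\<lambda>w A v. of_bool (F w A v < length w \<and> w ! F w A v))"
  using assms unfolding definable_def by (metis eval.simps(5))

lemma definable_tab:
  assumes "definable F"
  shows "definable (\<lambda>w A v. A (F w A v))"
  using assms unfolding definable_def by (metis eval.simps(6))

lemma definable_sum:
  assumes "definable F" and "definable G"
  shows "definable (\<lambda>w A v. \<Sum>i<F w A v. G w A (v(x := i)))"
proof -
  obtain e f where "\<And>w A v. F w A v = eval w A v e" "\<And>w A v. G w A v = eval w A v f"
    using assms unfolding definable_def by blast
  then show ?thesis by (intro definableI[of _ "Sum x e f"]) simp
qed

text \<open>A product is a sum of equal terms; the summation variable is chosen beyond all variables of the
  summand.\<close>
lemma definable_times:
  assumes "definable F" and "definable G"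
  shows "definable (\<lambda>w A v. F w A v * G w A v)"
proof -
  obtain e f where ef: "\<And>w A v. F w A v = eval w A v e" "\<And>w A v. G w A v = eval w A v f"
    using assms unfolding definable_def by blast
  have "eval w A (v(width f := i)) f = eval w A v f" for w A v i
    by (rule eval_cong) simp
  then show ?thesis by (intro definableI[of _ "Sum (width f) e f"]) (simp add: ef)
qed

lemma definable_power:
  assumes "definable F"
  shows "definable (\<lambda>w A v. F w A v ^ k)"
  by (induction k) (auto intro: definable_const definable_times assms)

lemma definable_not:
  assumes "definable (\<lambda>w A v. of_bool (P w A v))"
  shows "definable (\<lambda>w A v. of_bool (\<not> P w A v))"
proof -
  have "definable (\<lambda>w A v. 1 - of_bool (P w A v))"
    by (intro definable_minus definable_const assms)
  then show ?thesis by (rule definable_cong) simp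
qed

lemma definable_conj:
  assumes "definable (\<lambda>w A v. of_bool (P w A v))" and "definable (\<lambda>w A v. of_bool (Q w A v))"
  shows "definable (\<lambda>w A v. of_bool (P w A v \<and> Q w A v))"
  using definable_times[OF assms] by (rule definable_cong) (simp add: of_bool_conj)

lemma definable_disj:
  assumes "definable (\<lambda>w A v. of_bool (P w A v))" and "definable (\<lambda>w A v. of_bool (Q w A v))"
  shows "definable (\<lambda>w A v. of_bool (P w A v \<or> Q w A v))"
  using definable_not[OF definable_conj[OF assms[THEN definable_not]]] by (rule definable_cong) auto

lemma definable_le:
  assumes "definable F" and "definable G"
  shows "definable (\<lambda>w A v. of_bool (F w A v \<le> G w A v))"
proof -
  have "definable (\<lambda>w A v. 1 - (F w A v - G w A v))"
    by (intro definable_minus definable_const assms)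
  then show ?thesis by (rule definable_cong) auto
qed

lemma definable_less:
  assumes "definable F" and "definable G"
  shows "definable (\<lambda>w A v. of_bool (F w A v < G w A v))"
  using definable_not[OF definable_le[OF assms(2,1)]] by (rule definable_cong) (simp add: not_le)

lemma definable_eq:
  assumes "definable F" and "definable G"
  shows "definable (\<lambda>w A v. of_bool (F w A v = G w A v))"
  using definable_conj[OF definable_le[OF assms] definable_le[OF assms(2,1)]]
  by (rule definable_cong) (simp add: eq_iff)

lemma definable_if:
  assumes "definable (\<lambda>w A v. of_bool (P w A v))" and "definable F" and "definable G"
  shows "definable (\<lambda>w A v. if P w A v then F w A v else G w A v)"
proof -
  have "definable (\<lambda>w A v. of_bool (P w A v) * F w A v + of_bool (\<not> P w A v) * G w A v)"
    by (intro definable_plus definable_times definable_not assms)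
  then show ?thesis by (rule definable_cong) simp
qed

text \<open>Quantification over a range that depends on neither input nor variables is unfolded into a finite
  conjunction, so the body may depend on \<open>j\<close> in ways that are not expressible themselves, such as
  through an exponent.\<close>
lemma definable_all_const:
  fixes k :: nat
  assumes "\<And>j. j < k \<Longrightarrow> definable (\<lambda>w A v. of_bool (P j w A v))"
  shows "definable (\<lambda>w A v. of_bool (\<forall>j<k. P j w A v))"
  using assms
proof (induction k)
  case 0
  show ?case by (simp add: definable_const)
next
  case (Suc k)
  have "definable (\<lambda>w A v. of_bool ((\<forall>j<k. P j w A v) \<and> P k w A v))"
    using Suc by (intro definable_conj) auto
  then show ?case by (rule definable_cong) (auto simp: less_Suc_eq)
qed

lemma definable_ex_const:
  fixes k :: nat
  assumes "\<And>j. j < k \<Longrightarrow> definable (\<lambda>w A v. of_bool (P j w A v))"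
  shows "definable (\<lambda>w A v. of_bool (\<exists>j<k. P j w A v))"
proof -
  have "definable (\<lambda>w A v. of_bool (\<not> (\<forall>j<k. \<not> P j w A v)))"
    by (intro definable_not definable_all_const assms)
  then show ?thesis by (rule definable_cong) simp
qed

lemma definable_ex:
  assumes "definable F" and "definable (\<lambda>w A v. of_bool (P w A v))"
  shows "definable (\<lambda>w A v. of_bool (\<exists>i<F w A v. P w A (v(x := i))))"
proof -
  have "definable (\<lambda>w A v. of_bool (1 \<le> (\<Sum>i<F w A v. of_bool (P w A (v(x := i))) :: nat)))"
    using definable_le[OF definable_const definable_sum[OF assms]] .
  moreover have "1 \<le> (\<Sum>i<m. of_bool (Q i) :: nat) \<longleftrightarrow> (\<exists>i<m. Q i)" for Q and m :: nat
    by (induction m) (auto simp: less_Suc_eq)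
  ultimately show ?thesis by simp
qed

text \<open>The quotient \<open>a div b\<close> is the number of \<open>i < a\<close> with \<open>(i + 1) * b \<le> a\<close>.\<close>
lemma definable_div:
  assumes "definable F" and "definable G" and pos: "\<And>w A v. 0 < G w A v"
  shows "definable (\<lambda>w A v. F w A v div G w A v)"
proof -
  obtain e f where ef: "\<And>w A v. F w A v = eval w A v e" "\<And>w A v. G w A v = eval w A v f"
    using assms unfolding definable_def by blast
  define z where "z = max (width e) (width f)"
  have fresh: "F w A (v(z := i)) = F w A v" "G w A (v(z := i)) = G w A v" for w A v i
    unfolding ef by (auto intro!: eval_cong simp: z_def)
  have "definable (\<lambda>w A v. \<Sum>i<F w A v. (\<lambda>w A v. of_bool ((v z + 1) * G w A v \<le> F w A v)) w A (v(z := i)))"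
    by (intro definable_sum definable_le definable_times definable_plus definable_var
      definable_const assms)
  moreover have "(\<Sum>i<a. of_bool ((i + 1) * b \<le> a) :: nat) = a div b" if "0 < b" for a b :: nat
  proof -
    have "(\<Sum>i<a. of_bool ((i + 1) * b \<le> a) :: nat) = card {i. i < a \<and> (i + 1) * b \<le> a}"
      by (simp add: sum.If_cases of_bool_def Int_def)
    also have "{i. i < a \<and> (i + 1) * b \<le> a} = {..<a div b}"
    proof -
      have "i < a div b \<longleftrightarrow> (i + 1) * b \<le> a" for i
        using less_eq_div_iff_mult_less_eq[OF that, of "i + 1" a] by (simp add: Suc_le_eq)
      moreover have "i < a div b \<Longrightarrow> i < a" for i
        using div_le_dividend[of a b] by linarith
      ultimately show ?thesis by auto
    qed
    finally show ?thesis by simp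
  qed
  ultimately show ?thesis using pos by (simp add: fresh)
qed

lemma definable_mod:
  assumes "definable F" and "definable G" and "\<And>w A v. 0 < G w A v"
  shows "definable (\<lambda>w A v. F w A v mod G w A v)"
proof -
  have "definable (\<lambda>w A v. F w A v - F w A v div G w A v * G w A v)"
    by (intro definable_minus definable_times definable_div assms)
  then show ?thesis by (rule definable_cong) (simp add: minus_div_mult_eq_mod)
qed

section \<open>Polynomial bounds\<close>

definition poly_fun :: "(nat \<Rightarrow> nat) \<Rightarrow> bool" where
  "poly_fun f \<longleftrightarrow> (\<exists>p. \<forall>m. f m = poly p m)"

lemma poly_fun_id: "poly_fun (\<lambda>m. m)"
  unfolding poly_fun_def by (rule exI[of _ "[:0, 1:]"]) simp

lemma poly_fun_const: "poly_fun (\<lambda>m. k)"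
  unfolding poly_fun_def by (rule exI[of _ "[:k:]"]) simp

lemma poly_fun_add: "poly_fun f \<Longrightarrow> poly_fun g \<Longrightarrow> poly_fun (\<lambda>m. f m + g m)"
  unfolding poly_fun_def by (metis poly_add)

lemma poly_fun_Suc: "poly_fun f \<Longrightarrow> poly_fun (\<lambda>m. Suc (f m))"
  using poly_fun_add[OF _ poly_fun_const[of 1]] by simp

lemma poly_fun_mult: "poly_fun f \<Longrightarrow> poly_fun g \<Longrightarrow> poly_fun (\<lambda>m. f m * g m)"
  unfolding poly_fun_def by (metis poly_mult)

lemma poly_fun_compose: "poly_fun f \<Longrightarrow> poly_fun g \<Longrightarrow> poly_fun (\<lambda>m. f (g m))"
  unfolding poly_fun_def by (metis poly_pcompose)

lemmas poly_fun_intros = poly_fun_Suc poly_fun_id poly_fun_const poly_fun_add poly_fun_mult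

lemma poly_fun_val_bound: "poly_fun (val_bound e)"
proof (induction e)
  case (Sum x e f)
  have "poly_fun (\<lambda>m. val_bound e m * val_bound f (m + val_bound e m))"
    by (intro poly_fun_mult poly_fun_compose[OF Sum.IH(2)] poly_fun_add poly_fun_id Sum.IH(1))
  then show ?case by (simp add: fun_eq_iff)
qed (simp_all add: poly_fun_intros)

lemma poly_fun_cost: "poly_fun (cost e)"
proof (induction e)
  case (Sum x e f)
  have "poly_fun (\<lambda>m. cost e m + val_bound e m * (cost f (m + val_bound e m) + 7) + 8)"
    by (intro poly_fun_intros poly_fun_compose[OF Sum.IH(2)] Sum.IH(1) poly_fun_val_bound)
  then show ?case by simp
qed (simp_all add: poly_fun_intros)

text \<open>Coefficients are natural numbers, so a bound in terms of the number of vertices gives one in terms of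
  the input length.\<close>
lemma poly_nat_mono: "a \<le> b \<Longrightarrow> poly p a \<le> poly p (b :: nat)"
  by (induction p) (auto intro: add_mono mult_mono)

section \<open>Filling a table in polynomial time\<close>

definition starts_unary :: "bool list \<Rightarrow> nat \<Rightarrow> bool" where
  "starts_unary w n \<longleftrightarrow> (\<forall>j<n. j < length w \<and> w ! j) \<and> \<not> (n < length w \<and> w ! n)"

lemma runs_run:
  assumes "runs w c (\<lambda>_. 0) T R"
  shows "\<exists>t\<le>T. run (c 0) w t = (length (c 0), R)"
  using assms[unfolded runs_def, rule_format, of "[]" "[]"] by (simp add: run_def)

text \<open>This turns a recursive characterisation of a table into a polynomial-time machine. The machine
  consults a table whose entries from the current index on are still 0, which is why the recursion is
  phrased with such a truncated table. The unary number at the start of the input is the parameter \<open>n\<close>.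
  The entries are kept at most 1 so that the polynomial that bounds one evaluation does not depend on
  the values computed before.\<close>
theorem poly_time_by_table:
  assumes N: "definable (\<lambda>w A v. N (v 0))"
    and body: "definable (\<lambda>w A v. body w A (v 0) (v 1))"
    and final: "definable (\<lambda>w A v. final w A (v 0))"
    and rec: "\<And>x. x \<in> I \<Longrightarrow> \<exists>n g. starts_unary (enc x) n \<and>
      (\<forall>s<N n. g s \<le> 1 \<and> g s = body (enc x) (\<lambda>j. if j < s then g j else 0) n s) \<and>
      final (enc x) (\<lambda>j. if j < N n then g j else 0) n = of_bool (yes x)"
  shows "poly_time_solvable enc I yes"
proof -
  obtain eN eb ef where eN: "\<And>w A v. N (v 0) = eval w A v eN"
    and eb: "\<And>w A v. body w A (v 0) (v 1) = eval w A v eb"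
    and ef: "\<And>w A v. final w A (v 0) = eval w A v ef"
    using N body final unfolding definable_def by blast
  define d where "d = 3 + max (width eN) (max (width eb) (width ef))"
  define K where "K = d + 2 + room eN + room eb + room ef"
  have wd: "width eN < d" "width eb < d + 1" "width ef < d" and d: "2 < d" "d + 1 < K"
    and Kr: "d + room eN \<le> K" "d + 1 + room eb \<le> K" "d + room ef \<le> K"
    by (auto simp: d_def K_def)
  \<comment> \<open>The argument \<open>n\<close> is kept in register 1 and the index \<open>s\<close> in register 2, the registers of the
  variables 0 and 1. Register \<open>d\<close> controls both loops.\<close>
  let ?scan = "[Const 0 1, Add 1 1 0, Read d 1]"
  let ?store = "[Const 0 K, Add 0 0 2, Store 0 (d + 1), Const 0 1, Add 2 2 0, Sub d d 0]"
  let ?fill = "seq (compile K eb (d + 1)) (instrs ?store)"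
  define C where "C = seq (instrs [Const 1 0, Read d 1]) (seq (while_nz d (instrs ?scan))
    (seq (compile K eN d) (seq (while_nz d ?fill) (seq (compile K ef d)
      (instrs [Const 0 0, Add 0 d 0])))))"
  \<comment> \<open>A common bound for \<open>n\<close>, the index and the entries during the whole run.\<close>
  define mb where "mb n = n + val_bound eN n + 1" for n
  define T where "T n = 2 + ((n * (3 + 3) + 1) + (cost eN (mb n) +
    ((val_bound eN n * ((cost eb (mb n) + 6) + 3) + 1) + (cost ef (mb n) + 2))))" for n
  have "poly_fun T"
    unfolding T_def mb_def
    by (intro poly_fun_intros poly_fun_val_bound poly_fun_compose[OF poly_fun_cost])
  then obtain p where p: "\<And>n. T n = poly p n"
    unfolding poly_fun_def by blast
  have "\<exists>t\<le>poly p (length (enc x)). halted (C 0) (run (C 0) (enc x) t) \<and>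
      snd (run (C 0) (enc x) t) 0 = of_bool (yes x)" if "x \<in> I" for x
  proof -
    define w where "w = enc x"
    obtain n g where n: "starts_unary w n"
      and g: "\<And>s. s < N n \<Longrightarrow> g s \<le> 1"
        "\<And>s. s < N n \<Longrightarrow> g s = body w (\<lambda>j. if j < s then g j else 0) n s"
      and yes: "final w (\<lambda>j. if j < N n then g j else 0) n = of_bool (yes x)"
      using rec[OF \<open>x \<in> I\<close>] unfolding w_def by blast
    have len: "n \<le> length w"
      using n unfolding starts_unary_def by (meson not_le order.irrefl)
    let ?bit = "\<lambda>i. i < length w \<and> w ! i"
    define R0 where "R0 = (\<lambda>r. 0 :: nat)(d := of_bool (?bit 0))"
    have "fold (effect w) [Const 1 0, Read d 1] (\<lambda>_. 0) = R0"
      by (simp add: R0_def fun_eq_iff)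
    then have init: "runs w (instrs [Const 1 0, Read d 1]) (\<lambda>_. 0) 2 R0"
      using runs_instrs[of "[Const 1 0, Read d 1]" w "\<lambda>_. 0"]
      by (simp del: fold_simps add: numeral_2_eq_2)
    define Scan where "Scan i R \<longleftrightarrow> R 1 = i \<and> R d = of_bool (?bit i) \<and>
      (\<forall>r. r \<noteq> 0 \<longrightarrow> r \<noteq> 1 \<longrightarrow> r \<noteq> d \<longrightarrow> R r = 0)" for i and R :: "nat \<Rightarrow> nat"
    have "\<exists>R1. runs w (while_nz d (instrs ?scan)) R0 (n * (3 + 3) + 1) R1 \<and> Scan n R1"
    proof (rule runs_while)
      fix i R assume "i < n" and R: "Scan i R"
      let ?R = "fold (effect w) ?scan R"
      have "runs w (instrs ?scan) R 3 ?R"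
        using runs_instrs[of ?scan w R] by (simp del: fun_upd_apply fold_simps add: numeral_3_eq_3)
      moreover have "Scan (Suc i) (?R(0 := 0))"
        using R d unfolding Scan_def by simp
      moreover have "R d \<noteq> 0"
        using R n \<open>i < n\<close> unfolding Scan_def starts_unary_def by simp
      ultimately show "R d \<noteq> 0 \<and> (\<exists>R'. runs w (instrs ?scan) R 3 R' \<and> Scan (Suc i) (R'(0 := 0)))"
        by blast
    next
      show "R d = 0" if "Scan n R" for R
        using that n unfolding Scan_def starts_unary_def by simp
      show "Scan 0 R0"
        using d by (simp add: Scan_def R0_def)
    qed
    then obtain R1 where R1: "runs w (while_nz d (instrs ?scan)) R0 (n * (3 + 3) + 1) R1" "Scan n R1"
      by blast
    have R1_var: "R1 (Suc y) \<le> n" if "y < width eN" for y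
      using R1(2) that wd unfolding Scan_def by (cases "y = 0") auto
    have R1_tab: "R1 (K + s) = 0" for s
      using R1(2) d unfolding Scan_def by simp
    have "N n = eval w (table_of K R1) (vars_of R1) eN"
      using eN[of "vars_of R1" w "table_of K R1"] R1(2) by (simp add: Scan_def)
    moreover have "\<dots> \<le> val_bound eN n"
      using R1_var by (rule eval_le_val_bound) (simp_all add: R1_tab)
    ultimately have Nb: "N n \<le> val_bound eN n" and Nv: "eval w (table_of K R1) (vars_of R1) eN = N n"
      by simp_all
    have "R1 (Suc y) \<le> mb n" if "y < width eN" for y
      using R1_var[OF that] by (simp add: mb_def)
    moreover have "R1 (K + s) \<le> mb n" for s
      by (simp add: R1_tab)
    ultimately obtain R2 where R2: "runs w (compile K eN d) R1 (cost eN (mb n)) R2" "yields K d R1 (N n) R2"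
      using compile_runs[of eN d K R1 "mb n" w, OF wd(1) Kr(1)] unfolding Nv by blast
    define Fill where "Fill i R \<longleftrightarrow> R d = N n - i \<and> R 1 = n \<and> R 2 = i \<and>
      (\<forall>r. 2 < r \<longrightarrow> r < d \<longrightarrow> R r = 0) \<and> (\<forall>s. R (K + s) = (if s < i then g s else 0))"
      for i and R :: "nat \<Rightarrow> nat"
    have fill_var: "R (Suc y) \<le> mb n" if "Fill i R" "i \<le> N n" "Suc y < d" for i R y
    proof -
      consider "y = 0" | "y = 1" | "2 < Suc y" by linarith
      then show ?thesis
        using that Nb by cases (auto simp: Fill_def mb_def numeral_2_eq_2)
    qed
    have fill_tab: "R (K + s) \<le> mb n" if "Fill i R" "i \<le> N n" for i R s
      using that g(1)[of s] by (auto simp: Fill_def mb_def)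
    have "\<exists>R3. runs w (while_nz d ?fill) R2 (N n * ((cost eb (mb n) + 6) + 3) + 1) R3 \<and> Fill (N n) R3"
    proof (rule runs_while)
      fix i R assume i: "i < N n" and R: "Fill i R"
      let ?A = "\<lambda>j. if j < i then g j else 0"
      have tab: "table_of K R = ?A"
        using R unfolding Fill_def by blast
      have "eval w (table_of K R) (vars_of R) eb = body w ?A n i"
        using eb[of w ?A "vars_of R"] R unfolding tab by (simp add: Fill_def numeral_2_eq_2)
      also have "\<dots> = g i"
        using g(2)[OF i] by simp
      finally have val: "eval w (table_of K R) (vars_of R) eb = g i" .
      have var: "R (Suc y) \<le> mb n" if "y < width eb" for y
        using that fill_var[OF R, of y] i by (simp add: d_def)
      obtain R' where R': "runs w (compile K eb (d + 1)) R (cost eb (mb n)) R'"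
        "yields K (d + 1) R (g i) R'"
        using compile_runs[of eb "d + 1" K R "mb n" w, OF wd(2) Kr(2)] var fill_tab[OF R] i
        unfolding val by auto
      have fr: "R' r = R r" if "0 < r" "r < d + 1 \<or> K \<le> r" for r
        using R'(2) that unfolding yields_def by blast
      let ?S = "fold (effect w) ?store R'"
      have "runs w ?fill R (cost eb (mb n) + 6) ?S"
        using runs_instrs[of ?store w R']
        by (intro runs_seq[OF R'(1)]) (simp del: fun_upd_apply fold_simps add: numeral_eq_Suc)
      moreover have "Fill (Suc i) (?S(0 := 0))"
        using R R'(2) fr i d unfolding Fill_def yields_def by (auto simp: less_Suc_eq)
      moreover have "R d \<noteq> 0"
        using R i by (simp add: Fill_def)
      ultimately show "R d \<noteq> 0 \<and> (\<exists>R'. runs w ?fill R (cost eb (mb n) + 6) R' \<and> Fill (Suc i) (R'(0 := 0)))"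
        by blast
    next
      show "R d = 0" if "Fill (N n) R" for R
        using that by (simp add: Fill_def)
      have "R2 r = R1 r" if "0 < r" "r < d \<or> K \<le> r" for r
        using R2(2) that unfolding yields_def by blast
      then show "Fill 0 R2"
        using R2(2) R1(2) R1_tab d by (simp add: Fill_def yields_def Scan_def)
    qed
    then obtain R3 where R3: "runs w (while_nz d ?fill) R2 (N n * ((cost eb (mb n) + 6) + 3) + 1) R3"
      "Fill (N n) R3"
      by blast
    have "R3 (Suc y) \<le> mb n" if "y < width ef" for y
      using that fill_var[OF R3(2), of y] by (simp add: d_def)
    moreover have "eval w (table_of K R3) (vars_of R3) ef = of_bool (yes x)"
    proof -
      have "table_of K R3 = (\<lambda>j. if j < N n then g j else 0)"
        using R3(2) unfolding Fill_def by blast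
      then show ?thesis
        using ef[of w "table_of K R3" "vars_of R3"] R3(2) yes by (simp add: Fill_def)
    qed
    ultimately obtain R4 where R4: "runs w (compile K ef d) R3 (cost ef (mb n)) R4"
      "yields K d R3 (of_bool (yes x)) R4"
      using compile_runs[of ef d K R3 "mb n" w, OF wd(3) Kr(3)] fill_tab[OF R3(2)] by auto
    let ?R = "fold (effect w) [Const 0 0, Add 0 d 0] R4"
    have "runs w (instrs [Const 0 0, Add 0 d 0]) R4 2 ?R"
      using runs_instrs[of "[Const 0 0, Add 0 d 0]" w R4]
      by (simp del: fun_upd_apply fold_simps add: numeral_2_eq_2)
    then have "runs w C (\<lambda>_. 0) (2 + ((n * (3 + 3) + 1) + (cost eN (mb n) +
        ((N n * ((cost eb (mb n) + 6) + 3) + 1) + (cost ef (mb n) + 2))))) ?R"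
      unfolding C_def
      by (rule runs_seq[OF init runs_seq[OF R1(1) runs_seq[OF R2(1) runs_seq[OF R3(1) runs_seq[OF R4(1)]]]]])
    then obtain t where t: "t \<le> 2 + ((n * (3 + 3) + 1) + (cost eN (mb n) +
        ((N n * ((cost eb (mb n) + 6) + 3) + 1) + (cost ef (mb n) + 2))))"
      "run (C 0) w t = (length (C 0), ?R)"
      by (blast dest: runs_run)
    have "t \<le> T n"
      using t(1) mult_le_mono1[OF Nb, of "(cost eb (mb n) + 6) + 3"] unfolding T_def by linarith
    also have "T n \<le> poly p (length w)"
      unfolding p by (rule poly_nat_mono) (rule len)
    finally have "t \<le> poly p (length w)" .
    moreover have "?R 0 = of_bool (yes x)"
      using R4(2) d by (simp add: yields_def)
    ultimately show ?thesis
      using t(2) unfolding w_def by (auto simp: halted_def)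
  qed
  then show ?thesis unfolding poly_time_solvable_def by blast
qed

section \<open>Independence of a colour class is a local property\<close>

text \<open>Adjacency is inspected for increasing pairs only; for the symmetric adjacency relation of a graph this
  covers all pairs.\<close>
definition one_edge_pattern ::
    "(nat \<Rightarrow> nat \<Rightarrow> bool) \<Rightarrow> nat \<Rightarrow> nat set \<Rightarrow> nat \<Rightarrow> nat set \<Rightarrow> nat \<Rightarrow> nat set \<Rightarrow> bool" where
  "one_edge_pattern adj k F u M v B \<longleftrightarrow>
     card F = k \<and> card M = k \<and> card B = k \<and> adj u v \<and>
     (\<forall>x\<in>F. x < u) \<and> (\<forall>x\<in>M. u < x \<and> x < v) \<and> (\<forall>x\<in>B. v < x) \<and>
     (\<forall>x\<in>F \<union> M \<union> B \<union> {u, v}. \<forall>y\<in>F \<union> M \<union> B \<union> {u, v}. x < y \<longrightarrow> adj x y \<longrightarrow> x = u \<and> y = v)"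

text \<open>The \<open>k\<close> lowest elements. A key with values in another order makes the lemma also provide the highest
  ones.\<close>
lemma ex_lowest_subset:
  fixes f :: "'a \<Rightarrow> 'b::linorder"
  assumes "finite S" and "k \<le> card S"
  shows "\<exists>F\<subseteq>S. card F = k \<and> (\<forall>z\<in>F. card {y \<in> S. f y < f z} < k)"
  using assms(2)
proof (induction k)
  case 0
  then show ?case by (intro exI[of _ "{}"]) simp
next
  case (Suc k)
  then obtain F where F: "F \<subseteq> S" "card F = k" "\<forall>z\<in>F. card {y \<in> S. f y < f z} < k"
    by auto
  have fF: "finite F" using F(1) assms(1) finite_subset by blast
  have "S - F \<noteq> {}"
  proof
    assume "S - F = {}"
    then have "card S \<le> card F" using F(1) by (metis Diff_eq_empty_iff antisym order.refl)
    then show False using F(2) Suc.prems by simp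
  qed
  then obtain z where z: "z \<in> S - F" "\<forall>y\<in>S - F. f z \<le> f y"
    using ex_min_if_finite[of "f ` (S - F)"] assms(1) by (force simp: not_less)
  have "{y \<in> S. f y < f z} \<subseteq> F" using z by force
  then have "card {y \<in> S. f y < f z} \<le> k" using card_mono[OF fF] F(2) by blast
  then show ?case using F z(1) fF
    by (intro exI[of _ "insert z F"]) (auto simp: less_Suc_eq_le less_imp_le)
qed

text \<open>The three local conditions say that the later end \<open>x\<close> of a pair sees no neighbour among the first \<open>k\<close>
  elements and among the \<open>k\<close> elements directly before it, and that the earlier end sees none among the
  last \<open>k\<close> elements. An edge in \<open>A\<close> with the fewest elements of \<open>A\<close> between its ends escapes all three
  only if there are \<open>k\<close> elements on each side and in between, and then it is the edge of a pattern.\<close>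
theorem independent_if_locally_independent:
  fixes A :: "nat set"
  assumes fin: "finite A"
    and no_pattern: "\<And>F u M v B. F \<union> M \<union> B \<union> {u, v} \<subseteq> A \<Longrightarrow> \<not> one_edge_pattern adj k F u M v B"
    and first: "\<And>y x. y \<in> A \<Longrightarrow> x \<in> A \<Longrightarrow> y < x \<Longrightarrow> card {z \<in> A. z < y} < k \<Longrightarrow> \<not> adj y x"
    and recent: "\<And>y x. y \<in> A \<Longrightarrow> x \<in> A \<Longrightarrow> y < x \<Longrightarrow> card {z \<in> A. y < z \<and> z < x} < k \<Longrightarrow> \<not> adj y x"
    and last: "\<And>y x. y \<in> A \<Longrightarrow> x \<in> A \<Longrightarrow> y < x \<Longrightarrow> card {z \<in> A. x < z} < k \<Longrightarrow> \<not> adj y x"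
    and "u \<in> A" "v \<in> A" "u < v"
  shows "\<not> adj u v"
  using \<open>u \<in> A\<close> \<open>v \<in> A\<close> \<open>u < v\<close>
proof (induction "card {z \<in> A. u < z \<and> z < v}" arbitrary: u v rule: less_induct)
  case (less u v)
  let ?L = "{z \<in> A. z < u}" and ?C = "{z \<in> A. u < z \<and> z < v}" and ?R = "{z \<in> A. v < z}"
  have fins: "finite ?L" "finite ?C" "finite ?R" using fin by auto
  show ?case
  proof
    assume uv: "adj u v"
    then have "k \<le> card ?L" "k \<le> card ?C" "k \<le> card ?R"
      using first recent last less.prems not_le by blast+
    obtain F where F: "F \<subseteq> ?L" "card F = k" "\<forall>z\<in>F. card {y \<in> ?L. y < z} < k"
      using ex_lowest_subset[OF fins(1) \<open>k \<le> card ?L\<close>, of "\<lambda>y. y"] by blast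
    obtain M where M: "M \<subseteq> ?C" "card M = k"
      using obtain_subset_with_card_n[OF \<open>k \<le> card ?C\<close>] by blast
    obtain B where B: "B \<subseteq> ?R" "card B = k" "\<forall>z\<in>B. card {y \<in> ?R. - int y < - int z} < k"
      using ex_lowest_subset[OF fins(3) \<open>k \<le> card ?R\<close>, of "\<lambda>y. - int y"] by blast
    have sub: "F \<union> M \<union> B \<union> {u, v} \<subseteq> A"
      using F(1) M(1) B(1) less.prems by blast
    have FMB: "z \<in> F \<Longrightarrow> z < u" "z \<in> M \<Longrightarrow> u < z \<and> z < v" "z \<in> B \<Longrightarrow> v < z" for z
      using F(1) M(1) B(1) by auto
    have Fk: "card {y \<in> A. y < z} < k" if "z \<in> F" for z
    proof -
      have "{y \<in> A. y < z} = {y \<in> ?L. y < z}" using that F(1) by auto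
      then show ?thesis using F(3) that by simp
    qed
    have Bk: "card {y \<in> A. z < y} < k" if "z \<in> B" for z
    proof -
      have "{y \<in> A. z < y} = {y \<in> ?R. - int y < - int z}" using that B(1) by auto
      then show ?thesis using B(3) that by simp
    qed
    \<comment> \<open>Pairs inside the closed interval from \<open>u\<close> to \<open>v\<close> enclose strictly fewer elements of \<open>A\<close>.\<close>
    have inner: "\<not> adj x y" if "x \<in> insert u ?C" "y \<in> insert v ?C" "x < y" "\<not> (x = u \<and> y = v)" for x y
    proof (rule less.hyps)
      show "x \<in> A" "y \<in> A" "x < y" using that less.prems by auto
      have "{z \<in> A. x < z \<and> z < y} \<subset> ?C"
        using that less.prems by (auto simp: psubset_eq set_eq_iff)
      then show "card {z \<in> A. x < z \<and> z < y} < card ?C"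
        using fins(2) psubset_card_mono by blast
    qed
    have "x = u \<and> y = v"
      if xy: "x \<in> F \<union> M \<union> B \<union> {u, v}" "y \<in> F \<union> M \<union> B \<union> {u, v}" "x < y" "adj x y" for x y
    proof (rule ccontr)
      assume ne: "\<not> (x = u \<and> y = v)"
      have A: "x \<in> A" "y \<in> A" using sub xy by auto
      have "x \<notin> F" using first[OF A xy(3)] Fk xy(4) by blast
      moreover have "y \<notin> B" using last[OF A xy(3)] Bk xy(4) by blast
      moreover have "y \<notin> F" using \<open>x \<notin> F\<close> xy(1,3) less.prems(3) by (auto dest!: FMB)
      moreover have "x \<notin> B" using \<open>y \<notin> B\<close> xy(2,3) less.prems(3) by (auto dest!: FMB)
      ultimately have "x \<in> insert v (insert u ?C)" "y \<in> insert v (insert u ?C)"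
        using xy(1,2) M(1) by blast+
      then have "x \<in> insert u ?C" "y \<in> insert v ?C"
        using xy(3) less.prems(3) by auto
      then show False using inner[OF _ _ xy(3) ne] xy(4) by blast
    qed
    then have "one_edge_pattern adj k F u M v B"
      unfolding one_edge_pattern_def using F M B uv by blast
    then show False using no_pattern sub by blast
  qed
qed

section \<open>Windows of a colour class\<close>

text \<open>The vertices below \<open>p\<close> of colour \<open>i\<close>, the most recent one first: colouring another vertex then adds
  the head of the list.\<close>
definition members :: "(nat \<Rightarrow> nat) \<Rightarrow> nat \<Rightarrow> nat \<Rightarrow> nat list" where
  "members c i p = filter (\<lambda>v. c v = i) (rev [0..<p])"

lemma members_0 [simp]: "members c i 0 = []"
  by (simp add: members_def)

lemma members_Suc [simp]: "members c i (Suc p) = (if c p = i then p # members c i p else members c i p)"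
  by (simp add: members_def)

lemma set_members: "set (members c i p) = {v. v < p \<and> c v = i}"
  by (auto simp: members_def)

lemma sorted_members: "sorted_wrt (>) (members c i p)"
  by (induction p) (auto simp: set_members)

lemma members_cong: "(\<And>v. v < p \<Longrightarrow> c v = c' v) \<Longrightarrow> members c i p = members c' i p"
  by (auto simp: members_def intro!: filter_cong)

definition latest :: "nat \<Rightarrow> 'a list \<Rightarrow> 'a list" where
  "latest k xs = take k xs"

definition earliest :: "nat \<Rightarrow> 'a list \<Rightarrow> 'a list" where
  "earliest k xs = drop (length xs - k) xs"

lemma set_latest_subset: "set (latest k xs) \<subseteq> set xs"
  by (simp add: latest_def set_take_subset)

lemma set_earliest_subset: "set (earliest k xs) \<subseteq> set xs"
  by (simp add: earliest_def set_drop_subset)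

lemma length_latest: "length (latest k xs) \<le> k"
  by (simp add: latest_def)

lemma length_earliest: "length (earliest k xs) \<le> k"
  by (simp add: earliest_def)

text \<open>Windows are segments of a list, whereas the local conditions for independence count elements; this
  lemma and the next one translate between the two.\<close>
lemma in_latest:
  fixes xs :: "nat list"
  assumes "sorted_wrt (>) xs" and "x \<in> set xs" and "card {y \<in> set xs. x < y} < k"
  shows "x \<in> set (latest k xs)"
  using assms
proof (induction xs arbitrary: k)
  case (Cons a xs)
  obtain l where l: "k = Suc l" using Cons.prems(3) by (cases k) auto
  show ?case
  proof (cases "x = a")
    case False
    then have x: "x \<in> set xs" "x < a" using Cons.prems by auto
    then have "{y \<in> set (a # xs). x < y} = insert a {y \<in> set xs. x < y}" by auto
    moreover have "a \<notin> set xs" using Cons.prems(1) by auto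
    ultimately have "card {y \<in> set xs. x < y} < l" using Cons.prems(3) l by simp
    then show ?thesis using Cons.IH[of l] x Cons.prems(1) l by (simp add: latest_def)
  qed (simp add: l latest_def)
qed simp

lemma in_earliest:
  fixes xs :: "nat list"
  assumes "sorted_wrt (>) xs" and "x \<in> set xs" and "card {y \<in> set xs. y < x} < k"
  shows "x \<in> set (earliest k xs)"
  using assms
proof (induction xs)
  case (Cons a xs)
  show ?case
  proof (cases "length xs < k")
    case True
    then show ?thesis using Cons.prems(2) by (simp add: earliest_def)
  next
    case False
    have "sorted_wrt (>) ys \<Longrightarrow> distinct ys" for ys :: "nat list"
      by (induction ys) auto
    then have dist: "distinct xs" using Cons.prems(1) by simp
    have "x \<noteq> a"
    proof
      assume "x = a"
      then have "{y \<in> set (a # xs). y < x} = set xs" using Cons.prems(1) by auto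
      then show False using Cons.prems(3) False distinct_card[OF dist] by simp
    qed
    then have x: "x \<in> set xs" "x < a" using Cons.prems by auto
    then have "{y \<in> set (a # xs). y < x} = {y \<in> set xs. y < x}" by auto
    then have "x \<in> set (earliest k xs)" using Cons x by simp
    then show ?thesis using False by (simp add: earliest_def Suc_diff_le)
  qed
qed simp

text \<open>The digits of a number in base \<open>b\<close> as the entries of a list, least significant first. Only the digits
  that are cut off have to be smaller than the base, so the most significant entry of a state code may
  be arbitrarily large.\<close>
lemma horner_sum_div_power:
  fixes b :: nat
  assumes "\<forall>x\<in>set (take j xs). f x < b"
  shows "horner_sum f b xs div b ^ j = horner_sum f b (drop j xs)"
  using assms
proof (induction j arbitrary: xs)
  case (Suc j)
  show ?case
  proof (cases xs)
    case (Cons x ys)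
    then have "f x < b" and ys: "\<forall>x\<in>set (take j ys). f x < b" using Suc.prems by auto
    then have "horner_sum f b xs div b = horner_sum f b ys"
      unfolding Cons by simp
    then show ?thesis using Suc.IH[OF ys] by (simp add: div_mult2_eq Cons)
  qed simp
qed simp

lemma horner_sum_digit:
  fixes b :: nat
  assumes "\<forall>x\<in>set (take (Suc j) xs). f x < b"
  shows "horner_sum f b xs div b ^ j mod b = (if j < length xs then f (xs ! j) else 0)"
proof -
  have "\<forall>x\<in>set (take j xs). f x < b"
    using assms set_take_subset_set_take[of j "Suc j" xs] by auto
  then have "horner_sum f b xs div b ^ j = horner_sum f b (drop j xs)"
    by (rule horner_sum_div_power)
  moreover have "f (xs ! j) < b" if "j < length xs"
    using assms that by (simp add: take_Suc_conv_app_nth)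
  ultimately show ?thesis
    by (cases "j < length xs") (simp_all add: Cons_nth_drop_Suc[symmetric])
qed

lemma horner_sum_less_power:
  fixes b :: nat
  assumes "\<forall>x\<in>set xs. f x < b"
  shows "horner_sum f b xs < b ^ length xs"
  using assms
proof (induction xs)
  case (Cons x xs)
  then have "f x < b" "Suc (horner_sum f b xs) \<le> b ^ length xs" by auto
  then have "f x + b * horner_sum f b xs < b * Suc (horner_sum f b xs)" by simp
  also have "\<dots> \<le> b * b ^ length xs"
    using \<open>Suc _ \<le> _\<close> by (rule mult_le_mono2)
  finally show ?case by simp
qed simp

text \<open>The vertex \<open>v\<close> is coded by the digit \<open>v + 1\<close>, so that the digit 0 stands for the absence of a vertex and
  windows with fewer than \<open>k\<close> vertices need no separate length.\<close>
definition window_code :: "nat \<Rightarrow> nat list \<Rightarrow> nat" where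
  "window_code n xs = horner_sum Suc (Suc n) xs"

lemma window_code_less:
  assumes "\<forall>x\<in>set xs. x < n" and "length xs \<le> k"
  shows "window_code n xs < Suc n ^ k"
proof -
  have "window_code n xs < Suc n ^ length xs"
    unfolding window_code_def using assms(1) by (intro horner_sum_less_power) auto
  also have "\<dots> \<le> Suc n ^ k" using assms(2) by (intro power_increasing) auto
  finally show ?thesis .
qed

text \<open>For the code \<open>t\<close> of a window: \<open>v\<close> has no neighbour in the window.\<close>
definition clear :: "(nat \<Rightarrow> nat \<Rightarrow> bool) \<Rightarrow> nat \<Rightarrow> nat \<Rightarrow> nat \<Rightarrow> nat \<Rightarrow> bool" where
  "clear adj n k v t \<longleftrightarrow>
     (\<forall>j<k. t div Suc n ^ j mod Suc n = 0 \<or> \<not> adj v (t div Suc n ^ j mod Suc n - 1))"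

lemma clear_window_code:
  assumes "\<forall>x\<in>set xs. x < n" and "length xs \<le> k"
  shows "clear adj n k v (window_code n xs) \<longleftrightarrow> (\<forall>x\<in>set xs. \<not> adj v x)"
proof -
  have "window_code n xs div Suc n ^ j mod Suc n = (if j < length xs then Suc (xs ! j) else 0)" for j
    unfolding window_code_def using assms(1) set_take_subset[of "Suc j" xs]
    by (intro horner_sum_digit) auto
  then have "clear adj n k v (window_code n xs) \<longleftrightarrow> (\<forall>j<length xs. \<not> adj v (xs ! j))"
    using assms(2) unfolding clear_def by auto
  then show ?thesis by (simp add: all_set_conv_all_nth)
qed

text \<open>The modulus drops the oldest vertex of a full window.\<close>
definition push_last :: "nat \<Rightarrow> nat \<Rightarrow> nat \<Rightarrow> nat \<Rightarrow> nat" where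
  "push_last n k v t = (Suc v + Suc n * t) mod Suc n ^ k"

text \<open>A window with fewer than \<open>k\<close> vertices is recognised by its code: one more digit still fits below
  \<open>Suc n ^ k\<close>.\<close>
definition push_first :: "nat \<Rightarrow> nat \<Rightarrow> nat \<Rightarrow> nat \<Rightarrow> nat" where
  "push_first n k v t = (if Suc n * t < Suc n ^ k then Suc v + Suc n * t else t)"

lemma window_code_latest:
  assumes "\<forall>x\<in>set xs. x < n"
  shows "window_code n (latest k xs) = window_code n xs mod Suc n ^ k"
proof -
  have "window_code n xs = window_code n (latest k xs) + Suc n ^ length (latest k xs) * window_code n (drop k xs)"
    unfolding window_code_def latest_def by (metis append_take_drop_id horner_sum_append)
  moreover have "window_code n (latest k xs) < Suc n ^ k"
    using assms set_latest_subset[of k xs] length_latest by (intro window_code_less) auto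
  moreover have "length (latest k xs) = k \<or> drop k xs = []"
    by (auto simp: latest_def)
  ultimately show ?thesis by (auto simp: window_code_def)
qed

lemma window_code_latest_Cons:
  assumes "\<forall>x\<in>set (v # xs). x < n"
  shows "window_code n (latest k (v # xs)) = push_last n k v (window_code n (latest k xs))"
proof -
  have "window_code n (latest k (v # xs)) = (Suc v + Suc n * window_code n xs) mod Suc n ^ k"
    using window_code_latest[OF assms] by (simp add: window_code_def)
  also have "\<dots> = push_last n k v (window_code n (latest k xs))"
    unfolding push_last_def using assms window_code_latest[of xs n k]
    by (simp del: mult_Suc) (metis mod_add_right_eq mod_mult_right_eq add_Suc)
  finally show ?thesis .
qed

lemma window_code_ge_power: "xs \<noteq> [] \<Longrightarrow> Suc n ^ length xs \<le> Suc n * window_code n xs"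
proof (induction xs)
  case (Cons x xs)
  show ?case
  proof (cases "xs = []")
    case False
    then have "Suc n * Suc n ^ length xs \<le> Suc n * (Suc n * window_code n xs)"
      using Cons.IH by (intro mult_le_mono2)
    also have "\<dots> \<le> Suc n * window_code n (x # xs)"
      by (intro mult_le_mono2) (simp add: window_code_def)
    finally show ?thesis by simp
  qed (simp add: window_code_def)
qed simp

lemma window_code_earliest_Cons:
  assumes "\<forall>x\<in>set (v # xs). x < n" and "0 < k"
  shows "window_code n (earliest k (v # xs)) = push_first n k v (window_code n (earliest k xs))"
proof (cases "length xs < k")
  case True
  then have "earliest k (v # xs) = v # xs" "earliest k xs = xs" by (auto simp: earliest_def)
  moreover have "Suc n * window_code n xs < Suc n * Suc n ^ length xs"
    using assms(1) by (intro mult_less_mono2 window_code_less) auto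
  moreover have "Suc n ^ Suc (length xs) \<le> Suc n ^ k"
    using True by (intro power_increasing) auto
  ultimately show ?thesis by (simp add: push_first_def window_code_def)
next
  case False
  then have "earliest k (v # xs) = earliest k xs" "length (earliest k xs) = k"
    by (auto simp: earliest_def Suc_diff_le)
  moreover have "Suc n ^ length (earliest k xs) \<le> Suc n * window_code n (earliest k xs)"
    using \<open>length (earliest k xs) = k\<close> assms(2) by (intro window_code_ge_power) auto
  ultimately show ?thesis by (simp add: push_first_def)
qed

section \<open>States of the dynamic program\<close>

text \<open>A state is a number whose nine lowest digits in base \<open>Suc n ^ k\<close> are window codes, three for each
  colour: the first vertices, the latest vertices, and the guess of the final latest vertices. The
  remaining leading part is the number of vertices that have been coloured; being most significant, it
  makes every transition increase the state.\<close>
definition component :: "nat \<Rightarrow> nat \<Rightarrow> nat \<Rightarrow> nat \<Rightarrow> nat" where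
  "component n k j s = s div (Suc n ^ k) ^ j mod Suc n ^ k"

definition position :: "nat \<Rightarrow> nat \<Rightarrow> nat \<Rightarrow> nat" where
  "position n k s = s div (Suc n ^ k) ^ 9"

abbreviation (input) first_component :: "nat \<Rightarrow> nat \<Rightarrow> nat \<Rightarrow> nat \<Rightarrow> nat" where
  "first_component n k i s \<equiv> component n k (3 * i) s"

abbreviation (input) latest_component :: "nat \<Rightarrow> nat \<Rightarrow> nat \<Rightarrow> nat \<Rightarrow> nat" where
  "latest_component n k i s \<equiv> component n k (3 * i + 1) s"

abbreviation (input) guess_component :: "nat \<Rightarrow> nat \<Rightarrow> nat \<Rightarrow> nat \<Rightarrow> nat" where
  "guess_component n k i s \<equiv> component n k (3 * i + 2) s"

lemma component_less: "component n k j s < Suc n ^ k"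
  by (simp add: component_def)

lemma ex_state:
  assumes "\<And>i. i < 3 \<Longrightarrow> f i < Suc n ^ k \<and> t i < Suc n ^ k \<and> g i < Suc n ^ k"
  shows "\<exists>s. position n k s = p \<and>
    (\<forall>i<3. first_component n k i s = f i \<and> latest_component n k i s = t i \<and> guess_component n k i s = g i)"
proof -
  define ds where "ds = [f 0, t 0, g 0, f 1, t 1, g 1, f 2, t 2, g 2]"
  define s where "s = horner_sum id (Suc n ^ k) (ds @ [p])"
  have len: "length ds = 9" by (simp add: ds_def)
  have small: "\<forall>x\<in>set ds. id x < Suc n ^ k"
    using assms[of 0] assms[of 1] assms[of 2] by (simp add: ds_def)
  have "position n k s = p"
    unfolding position_def s_def using small len
    by (subst horner_sum_div_power) auto
  moreover have digit: "component n k j s = ds ! j" if "j < 9" for j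
    unfolding component_def s_def using small len that set_take_subset[of "Suc j" ds]
    by (subst horner_sum_digit) (auto simp: nth_append)
  moreover have "first_component n k i s = f i \<and> latest_component n k i s = t i \<and> guess_component n k i s = g i"
    if "i < 3" for i
  proof -
    have "i = 0 \<or> i = 1 \<or> i = 2" using that by linarith
    then show ?thesis by (elim disjE) (simp_all add: digit ds_def)
  qed
  ultimately show ?thesis by blast
qed

definition initial :: "nat \<Rightarrow> nat \<Rightarrow> nat \<Rightarrow> bool" where
  "initial n k s \<longleftrightarrow> position n k s = 0 \<and> (\<forall>i<3. first_component n k i s = 0 \<and> latest_component n k i s = 0)"

text \<open>The next vertex receives the colour \<open>i\<close>, provided that it has no neighbour in the three windows of this
  colour.\<close>
definition advance ::
    "(nat \<Rightarrow> nat \<Rightarrow> bool) \<Rightarrow> (nat \<Rightarrow> nat \<Rightarrow> bool) \<Rightarrow> nat \<Rightarrow> nat \<Rightarrow> nat \<Rightarrow> nat \<Rightarrow> nat \<Rightarrow> bool" where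
  "advance adj ok n k i s s' \<longleftrightarrow>
     position n k s < n \<and> position n k s' = Suc (position n k s) \<and> ok (position n k s) i \<and>
     (\<forall>r<3. clear adj n k (position n k s) (component n k (3 * i + r) s)) \<and>
     (\<forall>j<3.
        first_component n k j s' = (if j = i then push_first n k (position n k s) (first_component n k j s)
          else first_component n k j s) \<and>
        latest_component n k j s' = (if j = i then push_last n k (position n k s) (latest_component n k j s)
          else latest_component n k j s) \<and>
        guess_component n k j s' = guess_component n k j s)"

text \<open>At the end the window of latest vertices consists of the last vertices of the colour class, so here the
  guess is verified.\<close>
definition accepting :: "nat \<Rightarrow> nat \<Rightarrow> nat \<Rightarrow> bool" where
  "accepting n k s \<longleftrightarrow> position n k s = n \<and> (\<forall>i<3. latest_component n k i s = guess_component n k i s)"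

text \<open>What a state remembers about a partial colouring. The colouring is required to pass the three local
  tests at every vertex coloured so far, rather than to be proper.\<close>
definition realises ::
    "(nat \<Rightarrow> nat \<Rightarrow> bool) \<Rightarrow> (nat \<Rightarrow> nat \<Rightarrow> bool) \<Rightarrow> nat \<Rightarrow> nat \<Rightarrow> (nat \<Rightarrow> nat) \<Rightarrow> nat \<Rightarrow> bool" where
  "realises adj ok n k c s \<longleftrightarrow>
     (\<forall>v<position n k s. v < n \<and> c v < 3 \<and> ok v (c v) \<and>
        clear adj n k v (window_code n (earliest k (members c (c v) v))) \<and>
        clear adj n k v (window_code n (latest k (members c (c v) v))) \<and>
        clear adj n k v (guess_component n k (c v) s)) \<and>
     (\<forall>i<3. first_component n k i s = window_code n (earliest k (members c i (position n k s))) \<and>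
        latest_component n k i s = window_code n (latest k (members c i (position n k s))))"

definition reachable :: "(nat \<Rightarrow> nat \<Rightarrow> bool) \<Rightarrow> (nat \<Rightarrow> nat \<Rightarrow> bool) \<Rightarrow> nat \<Rightarrow> nat \<Rightarrow> nat \<Rightarrow> bool" where
  "reachable adj ok n k s \<longleftrightarrow> (\<exists>c. realises adj ok n k c s)"

lemma window_code_members_less:
  assumes "p \<le> n"
  shows "window_code n (earliest k (members c i p)) < Suc n ^ k" "window_code n (latest k (members c i p)) < Suc n ^ k"
proof -
  have "\<forall>x\<in>set (members c i p). x < n" using assms by (auto simp: set_members)
  then show "window_code n (earliest k (members c i p)) < Suc n ^ k" "window_code n (latest k (members c i p)) < Suc n ^ k"
    using set_earliest_subset[of k "members c i p"] set_latest_subset[of k "members c i p"]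
    by (intro window_code_less length_earliest length_latest; blast)+
qed

lemma window_code_members_Suc:
  assumes "p < n" and "0 < k"
  shows "window_code n (earliest k (members c i (Suc p))) = (if i = c p
      then push_first n k p (window_code n (earliest k (members c i p))) else window_code n (earliest k (members c i p)))"
    "window_code n (latest k (members c i (Suc p))) = (if i = c p
      then push_last n k p (window_code n (latest k (members c i p))) else window_code n (latest k (members c i p)))"
proof -
  have "\<forall>x\<in>set (p # members c i p). x < n" using assms(1) by (auto simp: set_members)
  then show "window_code n (earliest k (members c i (Suc p))) = (if i = c p
      then push_first n k p (window_code n (earliest k (members c i p))) else window_code n (earliest k (members c i p)))"
    "window_code n (latest k (members c i (Suc p))) = (if i = c p
      then push_last n k p (window_code n (latest k (members c i p))) else window_code n (latest k (members c i p)))"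
    using window_code_earliest_Cons[OF _ assms(2)] window_code_latest_Cons by auto
qed

lemma less_if_position_less: "position n k s < position n k s' \<Longrightarrow> s < s'"
  unfolding position_def by (meson div_le_mono not_le)

text \<open>Forgetting the last coloured vertex yields a predecessor; its digits are read off from the colouring,
  except for the guesses, which never change.\<close>
lemma realises_Suc:
  assumes c: "realises adj ok n k c s" and p: "position n k s = Suc p" and "0 < k"
  shows "\<exists>s'<s. realises adj ok n k c s' \<and> advance adj ok n k (c p) s' s"
proof -
  have pn: "p < n" and cp: "c p < 3" "ok p (c p)"
    "clear adj n k p (window_code n (earliest k (members c (c p) p)))"
    "clear adj n k p (window_code n (latest k (members c (c p) p)))"
    "clear adj n k p (guess_component n k (c p) s)"
    using c p unfolding realises_def by auto
  obtain s' where s': "position n k s' = p"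
    "\<forall>i<3. first_component n k i s' = window_code n (earliest k (members c i p)) \<and>
      latest_component n k i s' = window_code n (latest k (members c i p)) \<and> guess_component n k i s' = guess_component n k i s"
    using ex_state[of "\<lambda>i. window_code n (earliest k (members c i p))" n k
        "\<lambda>i. window_code n (latest k (members c i p))" "\<lambda>i. guess_component n k i s" p]
      window_code_members_less[of p n] component_less pn by auto
  have "realises adj ok n k c s'"
    using c s' p unfolding realises_def by auto
  moreover have "advance adj ok n k (c p) s' s"
  proof -
    have "clear adj n k p (component n k (3 * c p + r) s')" if "r < 3" for r
    proof -
      have "r = 0 \<or> r = 1 \<or> r = 2" using that by linarith
      then show ?thesis using cp s' by auto
    qed
    moreover have "first_component n k j s = (if j = c p then push_first n k p (first_component n k j s')
          else first_component n k j s') \<and>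
        latest_component n k j s = (if j = c p then push_last n k p (latest_component n k j s')
          else latest_component n k j s') \<and> guess_component n k j s = guess_component n k j s'" if "j < 3" for j
      using c s' that p window_code_members_Suc[OF pn assms(3), of c j] unfolding realises_def by auto
    ultimately show ?thesis
      unfolding advance_def using s'(1) p pn cp by auto
  qed
  moreover have "s' < s"
    using s'(1) p by (simp add: less_if_position_less[of n k])
  ultimately show ?thesis by blast
qed

lemma realises_advance:
  assumes c: "realises adj ok n k c s'" and adv: "advance adj ok n k i s' s" and "i < 3" and "0 < k"
  shows "realises adj ok n k (c(position n k s' := i)) s"
proof -
  define p where "p = position n k s'"
  let ?c = "c(p := i)"
  have p: "p < n" "position n k s = Suc p" "ok p i"
    using adv unfolding advance_def p_def by auto
  have cl: "clear adj n k p (component n k (3 * i + r) s')" if "r < 3" for r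
    using adv that unfolding advance_def p_def by auto
  have upd: "first_component n k j s = (if j = i then push_first n k p (first_component n k j s')
          else first_component n k j s')"
        "latest_component n k j s = (if j = i then push_last n k p (latest_component n k j s')
          else latest_component n k j s')" "guess_component n k j s = guess_component n k j s'" if "j < 3" for j
    using adv that unfolding advance_def p_def by auto
  have members: "members ?c j q = members c j q" if "q \<le> p" for j q
    using that by (intro members_cong) auto
  have rep: "first_component n k j s' = window_code n (earliest k (members ?c j p))"
    "latest_component n k j s' = window_code n (latest k (members ?c j p))" if "j < 3" for j
    using c that members[of p] unfolding realises_def p_def by auto
  have "v < n \<and> ?c v < 3 \<and> ok v (?c v) \<and>
        clear adj n k v (window_code n (earliest k (members ?c (?c v) v))) \<and>
        clear adj n k v (window_code n (latest k (members ?c (?c v) v))) \<and>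
        clear adj n k v (guess_component n k (?c v) s)" if "v < position n k s" for v
  proof (cases "v = p")
    case True
    then show ?thesis
      using p cl[of 0] cl[of 1] cl[of 2] rep[OF \<open>i < 3\<close>] upd(3)[OF \<open>i < 3\<close>] \<open>i < 3\<close> by simp
  next
    case False
    then have v: "v < p" "v < position n k s'" using that p by (auto simp: p_def)
    then show ?thesis
      using c members[of v] upd(3)[of "c v"] unfolding realises_def by auto
  qed
  moreover have "first_component n k j s = window_code n (earliest k (members ?c j (position n k s))) \<and>
        latest_component n k j s = window_code n (latest k (members ?c j (position n k s)))" if "j < 3" for j
    using upd[OF that] rep[OF that] window_code_members_Suc[OF p(1) assms(4), of ?c j] p(2) by auto
  ultimately show ?thesis unfolding realises_def p_def by blast
qed

text \<open>Reachability is defined by the existence of a colouring, and the recursion that computes it is a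
  theorem. Predecessors are smaller, so the table can be filled in increasing order.\<close>
theorem reachable_iff:
  assumes "0 < k"
  shows "reachable adj ok n k s \<longleftrightarrow>
    initial n k s \<or> (\<exists>s'<s. reachable adj ok n k s' \<and> (\<exists>i<3. advance adj ok n k i s' s))"
proof
  assume "reachable adj ok n k s"
  then obtain c where c: "realises adj ok n k c s" unfolding reachable_def by blast
  show "initial n k s \<or> (\<exists>s'<s. reachable adj ok n k s' \<and> (\<exists>i<3. advance adj ok n k i s' s))"
  proof (cases "position n k s")
    case 0
    then have "initial n k s"
      using c by (simp add: initial_def realises_def window_code_def earliest_def latest_def)
    then show ?thesis ..
  next
    case (Suc p)
    then have "c p < 3" using c by (simp add: realises_def)
    then show ?thesis using realises_Suc[OF c Suc assms] unfolding reachable_def by blast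
  qed
next
  assume "initial n k s \<or> (\<exists>s'<s. reachable adj ok n k s' \<and> (\<exists>i<3. advance adj ok n k i s' s))"
  then show "reachable adj ok n k s"
  proof
    assume "initial n k s"
    then have "realises adj ok n k (\<lambda>_. 0) s"
      by (simp add: initial_def realises_def window_code_def earliest_def latest_def)
    then show ?thesis unfolding reachable_def by blast
  next
    assume "\<exists>s'<s. reachable adj ok n k s' \<and> (\<exists>i<3. advance adj ok n k i s' s)"
    then show ?thesis using realises_advance[OF _ _ _ assms] unfolding reachable_def by blast
  qed
qed

definition colorable :: "(nat \<Rightarrow> nat \<Rightarrow> bool) \<Rightarrow> (nat \<Rightarrow> nat \<Rightarrow> bool) \<Rightarrow> nat \<Rightarrow> bool" where
  "colorable adj ok n \<longleftrightarrow> (\<exists>c. (\<forall>v<n. c v < 3 \<and> ok v (c v)) \<and> (\<forall>u<n. \<forall>v<n. adj u v \<longrightarrow> c u \<noteq> c v))"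

text \<open>A proper colouring passes all local tests, with the last vertices of its colour classes as guesses.
  Conversely, an accepting state certifies the three local conditions for each colour class, and these
  imply that the class is independent.\<close>
theorem colorable_iff_reachable:
  assumes "0 < k"
    and sym: "\<And>u v. u < n \<Longrightarrow> v < n \<Longrightarrow> adj u v \<Longrightarrow> adj v u"
    and irrefl: "\<And>v. v < n \<Longrightarrow> \<not> adj v v"
    and no_pattern: "\<And>F u M v B. F \<union> M \<union> B \<union> {u, v} \<subseteq> {..<n} \<Longrightarrow> \<not> one_edge_pattern adj k F u M v B"
  shows "colorable adj ok n \<longleftrightarrow>
    (\<exists>s < Suc n * (Suc n ^ k) ^ 9. reachable adj ok n k s \<and> accepting n k s)"
proof
  assume "colorable adj ok n"
  then obtain c where c: "\<And>v. v < n \<Longrightarrow> c v < 3 \<and> ok v (c v)"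
    "\<And>u v. u < n \<Longrightarrow> v < n \<Longrightarrow> adj u v \<Longrightarrow> c u \<noteq> c v"
    unfolding colorable_def by blast
  obtain s where s: "position n k s = n"
    "\<And>i. i < 3 \<Longrightarrow> first_component n k i s = window_code n (earliest k (members c i n))"
    "\<And>i. i < 3 \<Longrightarrow> latest_component n k i s = window_code n (latest k (members c i n))"
    "\<And>i. i < 3 \<Longrightarrow> guess_component n k i s = window_code n (latest k (members c i n))"
    using ex_state[of "\<lambda>i. window_code n (earliest k (members c i n))" n k
        "\<lambda>i. window_code n (latest k (members c i n))" "\<lambda>i. window_code n (latest k (members c i n))" n]
      window_code_members_less[of n n] by auto
  have clear: "clear adj n k v (window_code n xs)"
    if "v < n" "set xs \<subseteq> set (members c (c v) p)" "length xs \<le> k" "p \<le> n" for v xs p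
  proof -
    have sub: "x < n" "c x = c v" if "x \<in> set xs" for x
      using that \<open>set xs \<subseteq> _\<close> \<open>p \<le> n\<close> by (auto simp: set_members)
    then have "\<not> adj v x" if "x \<in> set xs" for x
      using c(2)[of v x] \<open>v < n\<close> that by auto
    then show ?thesis
      using clear_window_code[of xs n k adj v] sub(1) \<open>length xs \<le> k\<close> by blast
  qed
  have "realises adj ok n k c s"
    unfolding realises_def s(1)
  proof (intro conjI allI impI)
    fix v assume v: "v < n"
    show "v < n" "c v < 3" "ok v (c v)" using v c(1) by auto
    show "clear adj n k v (window_code n (earliest k (members c (c v) v)))"
      using v by (intro clear[of _ _ v] set_earliest_subset length_earliest) auto
    show "clear adj n k v (window_code n (latest k (members c (c v) v)))"
      using v by (intro clear[of _ _ v] set_latest_subset length_latest) auto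
    show "clear adj n k v (guess_component n k (c v) s)"
      using v c(1)[OF v] s(4) by (simp del: One_nat_def) (intro clear[of _ _ n] set_latest_subset length_latest; simp)
  qed (use s in auto)
  moreover have "accepting n k s" using s by (simp add: accepting_def)
  moreover have "s < Suc n * (Suc n ^ k) ^ 9"
    using s(1) unfolding position_def by (simp add: div_less_iff_less_mult[symmetric] del: mult_Suc)
  ultimately show "\<exists>s < Suc n * (Suc n ^ k) ^ 9. reachable adj ok n k s \<and> accepting n k s"
    unfolding reachable_def by blast
next
  assume "\<exists>s < Suc n * (Suc n ^ k) ^ 9. reachable adj ok n k s \<and> accepting n k s"
  then obtain c s where real: "realises adj ok n k c s" and acc: "accepting n k s"
    unfolding reachable_def by blast
  have full: "position n k s = n" using acc by (simp add: accepting_def)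
  have c: "c v < 3" "ok v (c v)"
    and clear: "clear adj n k v (window_code n (earliest k (members c (c v) v)))"
      "clear adj n k v (window_code n (latest k (members c (c v) v)))"
      "clear adj n k v (window_code n (latest k (members c (c v) n)))" if "v < n" for v
    using real acc that full unfolding realises_def accepting_def by auto
  have notadj: "\<not> adj v x"
    if "clear adj n k v (window_code n xs)" "set xs \<subseteq> set (members c i p)" "length xs \<le> k" "p \<le> n" "x \<in> set xs"
    for v xs i p x
  proof -
    have "\<forall>x\<in>set xs. x < n" using that(2,4) by (auto simp: set_members)
    then show ?thesis using clear_window_code[of xs n k adj v] that(1,3,5) by simp
  qed
  have indep: "\<not> adj u v" if uv: "u < n" "v < n" "u < v" "c u = i" "c v = i" for u v i
  proof -
    define A where "A = {v. v < n \<and> c v = i}"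
    have no_pattern_A: "\<not> one_edge_pattern adj k F u M v B" if "F \<union> M \<union> B \<union> {u, v} \<subseteq> A" for F u M v B
    proof (rule no_pattern)
      show "F \<union> M \<union> B \<union> {u, v} \<subseteq> {..<n}" using that by (auto simp: A_def)
    qed
    \<comment> \<open>The first two tests of \<open>y < x\<close> are made when \<open>x\<close> is coloured, the last one when \<open>y\<close> is: then \<open>x\<close> is
  only known through the guess.\<close>
    have before: "y \<in> set (members c (c x) x)" "adj y x \<Longrightarrow> adj x y" "x < n"
      if "y \<in> A" "x \<in> A" "y < x" for x y
      using that sym by (auto simp: A_def set_members)
    have first: "\<not> adj y x" if yx: "y \<in> A" "x \<in> A" "y < x" and "card {z \<in> A. z < y} < k" for x y
    proof -
      have "{z \<in> set (members c (c x) x). z < y} = {z \<in> A. z < y}"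
        using yx by (auto simp: A_def set_members)
      then have "y \<in> set (earliest k (members c (c x) x))"
        using in_earliest[OF sorted_members before(1)[OF yx]] that(4) by simp
      then have "\<not> adj x y"
        using notadj[OF clear(1)[OF before(3)[OF yx]] set_earliest_subset length_earliest]
          before(3)[OF yx] by simp
      then show ?thesis using before(2)[OF yx] by blast
    qed
    have recent: "\<not> adj y x"
      if yx: "y \<in> A" "x \<in> A" "y < x" and "card {z \<in> A. y < z \<and> z < x} < k" for x y
    proof -
      have "{z \<in> set (members c (c x) x). y < z} = {z \<in> A. y < z \<and> z < x}"
        using yx by (auto simp: A_def set_members)
      then have "y \<in> set (latest k (members c (c x) x))"
        using in_latest[OF sorted_members before(1)[OF yx]] that(4) by simp
      then have "\<not> adj x y"
        using notadj[OF clear(2)[OF before(3)[OF yx]] set_latest_subset length_latest]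
          before(3)[OF yx] by simp
      then show ?thesis using before(2)[OF yx] by blast
    qed
    have last: "\<not> adj y x" if yx: "y \<in> A" "x \<in> A" "y < x" and "card {z \<in> A. x < z} < k" for x y
    proof -
      have "x \<in> set (members c (c y) n)" "y < n" using yx by (auto simp: A_def set_members)
      moreover have "{z \<in> set (members c (c y) n). x < z} = {z \<in> A. x < z}"
        using yx by (auto simp: A_def set_members)
      ultimately have "x \<in> set (latest k (members c (c y) n))"
        using in_latest[OF sorted_members] that(4) by simp
      then show ?thesis
        using notadj[OF clear(3)[OF \<open>y < n\<close>] set_latest_subset length_latest] by simp
    qed
    have "finite A" "u \<in> A" "v \<in> A" using uv by (auto simp: A_def)
    then show ?thesis
      using independent_if_locally_independent[OF _ no_pattern_A first recent last] \<open>u < v\<close> by blast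
  qed
  have "c u \<noteq> c v" if "u < n" "v < n" "adj u v" for u v
  proof
    assume eq: "c u = c v"
    consider "u < v" | "u = v" | "v < u" by linarith
    then show False
    proof cases
      case 1
      then show False using indep[OF that(1,2) 1 refl eq[symmetric]] that(3) by blast
    next
      case 2
      then show False using irrefl that by blast
    next
      case 3
      then show False using indep[OF that(2,1) 3 refl eq] sym[OF that] by blast
    qed
  qed
  then show "colorable adj ok n" using c unfolding colorable_def by blast
qed

section \<open>The dynamic program is definable\<close>

text \<open>The adjacency matrix starts behind the unary number and its end marker, and the lists start behind the
  matrix.\<close>
definition adj_bit :: "bool list \<Rightarrow> nat \<Rightarrow> nat \<Rightarrow> nat \<Rightarrow> bool" where
  "adj_bit w n u v \<longleftrightarrow> Suc n + u * n + v < length w \<and> w ! (Suc n + u * n + v)"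

definition list_bit :: "bool list \<Rightarrow> nat \<Rightarrow> nat \<Rightarrow> nat \<Rightarrow> bool" where
  "list_bit w n v i \<longleftrightarrow> Suc n + n * n + v * 3 + i < length w \<and> w ! (Suc n + n * n + v * 3 + i)"

lemma definable_Suc: "definable F \<Longrightarrow> definable (\<lambda>w A v. Suc (F w A v))"
  using definable_plus[OF _ definable_const[of 1]] by simp

lemmas definable_arith = definable_const definable_var definable_Suc definable_plus definable_minus
  definable_times definable_power

lemmas definable_logic = definable_le definable_less definable_eq definable_not definable_conj
  definable_disj definable_if

lemma definable_adj_bit:
  assumes "definable N" and "definable F" and "definable G"
  shows "definable (\<lambda>w A v. of_bool (adj_bit w (N w A v) (F w A v) (G w A v)))"
  unfolding adj_bit_def by (intro definable_bit definable_arith assms)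

lemma definable_list_bit:
  assumes "definable N" and "definable F"
  shows "definable (\<lambda>w A v. of_bool (list_bit w (N w A v) (F w A v) i))"
  unfolding list_bit_def by (intro definable_bit definable_arith assms)

lemma definable_clear:
  assumes "definable N" and "definable F" and "definable G"
  shows "definable (\<lambda>w A v. of_bool (clear (adj_bit w (N w A v)) (N w A v) k (F w A v) (G w A v)))"
  unfolding clear_def
  by (intro definable_all_const definable_logic definable_adj_bit definable_div definable_mod
      definable_arith assms) simp_all

lemma definable_component:
  assumes "definable N" and "definable S"
  shows "definable (\<lambda>w A v. component (N w A v) k j (S w A v))"
  unfolding component_def
  by (intro definable_div definable_mod definable_arith assms) simp_all

lemma definable_position:
  assumes "definable N" and "definable S"
  shows "definable (\<lambda>w A v. position (N w A v) k (S w A v))"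
  unfolding position_def by (intro definable_div definable_arith assms) simp_all

lemma definable_push_last:
  assumes "definable N" and "definable F" and "definable G"
  shows "definable (\<lambda>w A v. push_last (N w A v) k (F w A v) (G w A v))"
  unfolding push_last_def by (intro definable_mod definable_arith assms) simp_all

lemma definable_push_first:
  assumes "definable N" and "definable F" and "definable G"
  shows "definable (\<lambda>w A v. push_first (N w A v) k (F w A v) (G w A v))"
  unfolding push_first_def by (intro definable_logic definable_arith assms)

lemmas definable_state = definable_component definable_position definable_push_last definable_push_first
  definable_clear definable_list_bit

lemma definable_initial:
  assumes "definable N" and "definable S"
  shows "definable (\<lambda>w A v. of_bool (initial (N w A v) k (S w A v)))"
  unfolding initial_def
  by (intro definable_all_const definable_logic definable_state definable_const assms)

lemma definable_accepting:
  assumes "definable N" and "definable S"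
  shows "definable (\<lambda>w A v. of_bool (accepting (N w A v) k (S w A v)))"
  unfolding accepting_def
  by (intro definable_all_const definable_logic definable_state definable_const assms)

lemma definable_advance:
  assumes "definable N" and "definable S" and "definable S'"
  shows "definable (\<lambda>w A v. of_bool (advance (adj_bit w (N w A v)) (list_bit w (N w A v)) (N w A v) k i
    (S w A v) (S' w A v)))"
proof -
  have select: "definable (\<lambda>w A v. of_bool (F w A v = (if j = i then G w A v else H w A v)))"
    if "definable F" "definable G" "definable H" for F G H :: "bool list \<Rightarrow> (nat \<Rightarrow> nat) \<Rightarrow> (nat \<Rightarrow> nat) \<Rightarrow> nat"
      and j :: nat
    using that by (cases "j = i") (simp_all add: definable_eq)
  show ?thesis
    unfolding advance_def
    by (intro definable_all_const definable_conj select definable_less definable_eq definable_state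
        definable_Suc definable_const assms)
qed

text \<open>Table entries are 1 for reachable states and 0 otherwise.\<close>
definition dp_step :: "nat \<Rightarrow> bool list \<Rightarrow> (nat \<Rightarrow> nat) \<Rightarrow> nat \<Rightarrow> nat \<Rightarrow> nat" where
  "dp_step k w A n s = of_bool (initial n k s \<or>
     (\<exists>s'<s. A s' = 1 \<and> (\<exists>i<3. advance (adj_bit w n) (list_bit w n) n k i s' s)))"

definition dp_answer :: "nat \<Rightarrow> bool list \<Rightarrow> (nat \<Rightarrow> nat) \<Rightarrow> nat \<Rightarrow> nat" where
  "dp_answer k w A n = of_bool (\<exists>s < Suc n * (Suc n ^ k) ^ 9. A s = 1 \<and> accepting n k s)"

lemma definable_dp_step: "definable (\<lambda>w A v. dp_step k w A (v 0) (v 1))"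
proof -
  \<comment> \<open>The variable 2 is bound by the quantifier over predecessors.\<close>
  have "definable (\<lambda>w A v. of_bool (A (v 2) = 1 \<and>
      (\<exists>i<3. advance (adj_bit w (v 0)) (list_bit w (v 0)) (v 0) k i (v 2) (v 1))))"
    by (intro definable_conj definable_eq definable_tab definable_var definable_const
        definable_ex_const definable_advance)
  from definable_disj[OF definable_initial[OF definable_var[of 0] definable_var[of 1]]
      definable_ex[OF definable_var[of 1] this, of 2]]
  show ?thesis by (rule definable_cong) (simp add: dp_step_def)
qed

lemma definable_dp_answer: "definable (\<lambda>w A v. dp_answer k w A (v 0))"
proof -
  have "definable (\<lambda>w A v. of_bool (A (v 1) = 1 \<and> accepting (v 0) k (v 1)))"
    by (intro definable_conj definable_eq definable_tab definable_var definable_const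
        definable_accepting)
  moreover have "definable (\<lambda>w A v. Suc (v 0) * (Suc (v 0) ^ k) ^ 9)"
    by (intro definable_arith)
  ultimately have "definable (\<lambda>w A v. of_bool (\<exists>s<Suc (v 0) * (Suc (v 0) ^ k) ^ 9.
      A ((v(1 := s)) 1) = 1 \<and> accepting ((v(1 := s)) 0) k ((v(1 := s)) 1)))"
    by (rule definable_ex[rotated])
  then show ?thesis by (rule definable_cong) (simp add: dp_answer_def)
qed

section \<open>Reading an encoded instance\<close>

lemma length_concat_map:
  "(\<And>x. x \<in> set xs \<Longrightarrow> length (f x) = m) \<Longrightarrow> length (concat (map f xs)) = length xs * m"
  by (induction xs) auto

lemma nth_concat_map:
  assumes "\<And>x. x \<in> set xs \<Longrightarrow> length (f x) = m" and "i < length xs" and "j < m"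
  shows "concat (map f xs) ! (i * m + j) = f (xs ! i) ! j"
  using assms
proof (induction xs arbitrary: i)
  case (Cons x xs)
  then show ?case by (cases i) (auto simp: nth_append)
qed simp

lemma index_less: "i < a \<Longrightarrow> j < b \<Longrightarrow> i * b + j < a * (b :: nat)"
proof -
  assume "i < a" "j < b"
  then have "i * b + j < Suc i * b" by simp
  also have "\<dots> \<le> a * b" using \<open>i < a\<close> by (intro mult_le_mono1) simp
  finally show ?thesis .
qed

text \<open>The vertices of the dynamic program are the indices of the increasing enumeration of all vertices of
  the graph, so that the order of the graph becomes the order of the natural numbers.\<close>
definition graph_adj :: "'a ograph \<Rightarrow> nat \<Rightarrow> nat \<Rightarrow> bool" where
  "graph_adj G i j \<longleftrightarrow> {ordered_verts G ! i, ordered_verts G ! j} \<in> edges G"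

context
  fixes G :: "nat ograph" and L :: "nat \<Rightarrow> nat set" and w :: "bool list" and n :: nat
  defines "w \<equiv> encode (G, L)" and "n \<equiv> length (ordered_verts G)"
begin

lemma encode_blocks:
  obtains row lst where "w = replicate n True @ [False] @ row @ lst"
    "length row = n * n" "length lst = n * 3"
    "\<And>u v. u < n \<Longrightarrow> v < n \<Longrightarrow> row ! (u * n + v) = graph_adj G u v"
    "\<And>v i. v < n \<Longrightarrow> i < 3 \<Longrightarrow> lst ! (v * 3 + i) = (Suc i \<in> L (ordered_verts G ! v))"
proof -
  define vs where "vs = ordered_verts G"
  define row where "row = concat (map (\<lambda>u. map (\<lambda>v. {u, v} \<in> edges G) vs) vs)"
  define lst where "lst = concat (map (\<lambda>v. map (\<lambda>i. i \<in> L v) [1, 2, 3]) vs)"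
  have n: "length vs = n" by (simp add: n_def vs_def)
  have "w = replicate n True @ [False] @ row @ lst"
    by (simp add: w_def encode_def n_def row_def lst_def vs_def Let_def)
  moreover have "length row = n * n"
    unfolding row_def using n by (subst length_concat_map[where m = n]) auto
  moreover have "length lst = n * 3"
    unfolding lst_def using n by (subst length_concat_map[where m = 3]) auto
  moreover have "row ! (u * n + v) = graph_adj G u v" if "u < n" "v < n" for u v
    unfolding row_def using that n by (subst nth_concat_map) (auto simp: graph_adj_def vs_def)
  moreover have "lst ! (v * 3 + i) = (Suc i \<in> L (ordered_verts G ! v))" if "v < n" "i < 3" for v i
  proof -
    have "i = 0 \<or> i = 1 \<or> i = 2" using that by linarith
    then show ?thesis
      unfolding lst_def using that n
      by (subst nth_concat_map) (auto simp: vs_def numeral_3_eq_3 numeral_2_eq_2)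
  qed
  ultimately show ?thesis using that by blast
qed

lemma starts_unary_encode: "starts_unary w n"
  by (rule encode_blocks) (auto simp: starts_unary_def nth_append)

lemma adj_bit_encode:
  assumes "u < n" and "v < n"
  shows "adj_bit w n u v \<longleftrightarrow> graph_adj G u v"
proof (rule encode_blocks)
  fix row lst
  assume w: "w = replicate n True @ [False] @ row @ lst" and len: "length row = n * n"
    and row: "\<And>u v. u < n \<Longrightarrow> v < n \<Longrightarrow> row ! (u * n + v) = graph_adj G u v"
  have "u * n + v < length row" using index_less[OF assms] len by simp
  then show ?thesis
    using row[OF assms] by (simp add: adj_bit_def w nth_append add.assoc)
qed

lemma list_bit_encode:
  assumes "v < n" and "i < 3"
  shows "list_bit w n v i \<longleftrightarrow> Suc i \<in> L (ordered_verts G ! v)"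
proof (rule encode_blocks)
  fix row lst
  assume w: "w = replicate n True @ [False] @ row @ lst" and len: "length row = n * n" "length lst = n * 3"
    and lst: "\<And>v i. v < n \<Longrightarrow> i < 3 \<Longrightarrow> lst ! (v * 3 + i) = (Suc i \<in> L (ordered_verts G ! v))"
  have "v * 3 + i < length lst" using index_less[OF assms] len by simp
  then show ?thesis
    using lst[OF assms] len(1) by (simp add: list_bit_def w nth_append add.assoc)
qed

end

lemma ordered_verts:
  assumes "ordered_graph G"
  shows "set (ordered_verts G) = verts G" and "distinct (ordered_verts G)"
    and "i < j \<Longrightarrow> j < length (ordered_verts G) \<Longrightarrow>
      ord G (ordered_verts G ! i) < ord G (ordered_verts G ! j)"
proof -
  let ?xs = "sorted_list_of_set (ord G ` verts G)"
  have fin: "finite (verts G)" and inj: "inj_on (ord G) (verts G)"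
    using assms by (auto simp: ordered_graph_def)
  then have xs: "set ?xs = ord G ` verts G" "sorted_wrt (<) ?xs" by simp_all
  show "set (ordered_verts G) = verts G"
    unfolding ordered_verts_def using xs(1) inj by simp
  show "distinct (ordered_verts G)"
    unfolding ordered_verts_def using xs(1) by (simp add: distinct_map inj_on_inv_into)
  have "ord G (ordered_verts G ! i) = ?xs ! i" if "i < length (ordered_verts G)" for i
    using that xs(1) nth_mem[of i ?xs] unfolding ordered_verts_def
    by (simp add: f_inv_into_f)
  then show "i < j \<Longrightarrow> j < length (ordered_verts G) \<Longrightarrow>
      ord G (ordered_verts G ! i) < ord G (ordered_verts G ! j)"
    using sorted_wrt_nth_less[OF xs(2)] by (simp add: ordered_verts_def)
qed

lemma graph_adj_commute: "graph_adj G i j = graph_adj G j i"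
  by (simp add: graph_adj_def insert_commute)

lemma graph_adj_irrefl: "ordered_graph G \<Longrightarrow> \<not> graph_adj G i i"
  by (auto simp: graph_adj_def ordered_graph_def)

text \<open>The colours 1, 2, 3 are represented by 0, 1, 2.\<close>
lemma list_coloring_iff_colorable:
  assumes G: "ordered_graph G"
  shows "(\<exists>c. list_coloring G L c) \<longleftrightarrow>
    colorable (graph_adj G) (\<lambda>v i. Suc i \<in> L (ordered_verts G ! v)) (length (ordered_verts G))"
proof
  let ?vs = "ordered_verts G"
  assume "\<exists>c. list_coloring G L c"
  then obtain c where c: "list_coloring G L c" ..
  have c1: "c (?vs ! v) \<in> {1, 2, 3}" "c (?vs ! v) \<in> L (?vs ! v)" if "v < length ?vs" for v
    using c nth_mem[OF that] ordered_verts(1)[OF G] by (auto simp: list_coloring_def)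
  show "colorable (graph_adj G) (\<lambda>v i. Suc i \<in> L (?vs ! v)) (length ?vs)"
    unfolding colorable_def
  proof (intro exI[of _ "\<lambda>v. c (?vs ! v) - 1"] conjI allI impI)
    fix v assume v: "v < length ?vs"
    have "Suc (c (?vs ! v) - 1) = c (?vs ! v)" using c1(1)[OF v] by auto
    then show "c (?vs ! v) - 1 < 3" "Suc (c (?vs ! v) - 1) \<in> L (?vs ! v)"
      using c1[OF v] by auto
  next
    fix u v assume "u < length ?vs" "v < length ?vs" "graph_adj G u v"
    moreover from this have "c (?vs ! u) \<noteq> c (?vs ! v)"
      using c by (simp add: list_coloring_def graph_adj_def)
    ultimately show "c (?vs ! u) - 1 \<noteq> c (?vs ! v) - 1"
      using c1(1)[of u] c1(1)[of v] by auto
  qed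
next
  let ?vs = "ordered_verts G"
  assume "colorable (graph_adj G) (\<lambda>v i. Suc i \<in> L (?vs ! v)) (length ?vs)"
  then obtain c where c: "\<And>v. v < length ?vs \<Longrightarrow> c v < 3 \<and> Suc (c v) \<in> L (?vs ! v)"
    "\<And>u v. u < length ?vs \<Longrightarrow> v < length ?vs \<Longrightarrow> graph_adj G u v \<Longrightarrow> c u \<noteq> c v"
    unfolding colorable_def by blast
  define idx where "idx = inv_into {..<length ?vs} ((!) ?vs)"
  have idx: "idx (?vs ! i) = i" if "i < length ?vs" for i
    unfolding idx_def using ordered_verts(2)[OF G] that
    by (intro inv_into_f_f) (auto simp: inj_on_nth)
  have ex: "\<exists>i<length ?vs. x = ?vs ! i" if "x \<in> verts G" for x
    using that ordered_verts(1)[OF G] by (metis in_set_conv_nth)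
  have "list_coloring G L (\<lambda>x. Suc (c (idx x)))"
    unfolding list_coloring_def
  proof (intro conjI ballI allI impI)
    fix x assume "x \<in> verts G"
    then obtain i where i: "i < length ?vs" "x = ?vs ! i" using ex by blast
    then have "c i < 3" "Suc (c i) \<in> L x" using c(1) by auto
    then show "Suc (c (idx x)) \<in> {1, 2, 3}" "Suc (c (idx x)) \<in> L x"
      using i by (auto simp: idx)
  next
    fix x y assume e: "{x, y} \<in> edges G"
    then have "x \<in> verts G" "y \<in> verts G"
      using G by (auto simp: ordered_graph_def)
    then obtain i j where i: "i < length ?vs" "x = ?vs ! i" and j: "j < length ?vs" "y = ?vs ! j"
      using ex by metis
    then show "Suc (c (idx x)) \<noteq> Suc (c (idx y))"
      using c(2)[of i j] e by (simp add: idx graph_adj_def)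
  qed
  then show "\<exists>c. list_coloring G L c" by blast
qed

lemma colorable_cong:
  assumes "\<And>u v. u < n \<Longrightarrow> v < n \<Longrightarrow> adj u v = adj' u v"
    and "\<And>v i. v < n \<Longrightarrow> i < 3 \<Longrightarrow> ok v i = ok' v i"
  shows "colorable adj ok n = colorable adj' ok' n"
  unfolding colorable_def using assms by (intro arg_cong[of _ _ Ex] ext) auto

section \<open>Embedding a one-edge ordered graph into the pattern\<close>

lemma ex_order_embedding:
  fixes key :: "'a \<Rightarrow> real" and T :: "nat set"
  assumes "finite S" and "finite T" and "card S \<le> card T"
  shows "\<exists>h. (\<forall>x\<in>S. h x \<in> T) \<and> (\<forall>x\<in>S. \<forall>y\<in>S. key x < key y \<longrightarrow> h x < h y)"
proof -
  \<comment> \<open>An element is sent to the element of \<open>T\<close> that has the same rank.\<close>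
  define r where "r x = card {z \<in> S. key z < key x}" for x
  let ?ts = "sorted_list_of_set T"
  have ts: "sorted_wrt (<) ?ts" "set ?ts = T" "length ?ts = card T"
    using assms(2) by simp_all
  have mono: "r x < r y" if "x \<in> S" "key x < key y" for x y
    unfolding r_def using assms(1) that by (intro psubset_card_mono) (auto simp: psubset_eq set_eq_iff)
  have r: "r x < card T" if "x \<in> S" for x
  proof -
    have "r x < card S"
      unfolding r_def using assms(1) that by (intro psubset_card_mono) (auto simp: psubset_eq set_eq_iff)
    then show ?thesis using assms(3) by simp
  qed
  show ?thesis
  proof (intro exI[of _ "\<lambda>x. ?ts ! r x"] conjI ballI impI)
    show "?ts ! r x \<in> T" if "x \<in> S" for x
      using nth_mem[of "r x" ?ts] r[OF that] ts by simp
    show "?ts ! r x < ?ts ! r y" if "x \<in> S" "y \<in> S" "key x < key y" for x y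
      using sorted_wrt_nth_less[OF ts(1) mono] that r ts(3) by simp
  qed
qed

lemma edges_at_most_one:
  assumes "ordered_graph H" and "card (edges H) \<le> 1"
  obtains "edges H = {}" | a b where "a \<in> verts H" "b \<in> verts H" "ord H a < ord H b" "edges H = {{a, b}}"
proof -
  have "edges H \<subseteq> Pow (verts H)" "finite (verts H)"
    using assms(1) by (auto simp: ordered_graph_def)
  then have "finite (edges H)" by (meson finite_Pow_iff finite_subset)
  then consider "edges H = {}" | e where "edges H = {e}"
    using assms(2) by (metis card_1_singletonE card_eq_0_iff le_Suc_eq le_zero_eq One_nat_def)
  then show thesis
  proof cases
    case 2
    then have "card e = 2" "e \<subseteq> verts H" using assms(1) by (auto simp: ordered_graph_def)
    then obtain a b where ab: "e = {a, b}" "a \<noteq> b" by (meson card_2_iff)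
    then have "ord H a \<noteq> ord H b"
      using assms(1) \<open>e \<subseteq> verts H\<close> by (auto simp: ordered_graph_def dest: inj_onD)
    then consider "ord H a < ord H b" | "ord H b < ord H a" by linarith
    then show thesis
      using that(2)[of a b] that(2)[of b a] 2 ab \<open>e \<subseteq> verts H\<close> by cases (auto simp: insert_commute)
  qed (use that in blast)
qed

text \<open>The ends of the edge go to \<open>u\<close> and \<open>v\<close>, the vertices before, between and behind them to \<open>F\<close>, \<open>M\<close> and
  \<open>B\<close>. Without an edge, all vertices go to \<open>F\<close>.\<close>
lemma pattern_embedding:
  assumes H: "ordered_graph H" "card (edges H) \<le> 1" and k: "card (verts H) \<le> k"
    and fin: "finite F" "finite M" "finite B"
    and pat: "one_edge_pattern adj k F u M v B"
  shows "\<exists>h. h ` verts H \<subseteq> F \<union> M \<union> B \<union> {u, v} \<and>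
    (\<forall>x\<in>verts H. \<forall>y\<in>verts H. ord H x < ord H y \<longrightarrow>
      h x < h y \<and> (adj (h x) (h y) \<longleftrightarrow> {x, y} \<in> edges H))"
proof -
  have finH: "finite (verts H)" using H(1) by (simp add: ordered_graph_def)
  have cards: "card F = k" "card M = k" "card B = k" and uv: "adj u v"
    and F: "\<And>x. x \<in> F \<Longrightarrow> x < u" and M: "\<And>x. x \<in> M \<Longrightarrow> u < x" "\<And>x. x \<in> M \<Longrightarrow> x < v"
    and B: "\<And>x. x \<in> B \<Longrightarrow> v < x"
    and only: "\<And>x y. x \<in> F \<union> M \<union> B \<union> {u, v} \<Longrightarrow> y \<in> F \<union> M \<union> B \<union> {u, v} \<Longrightarrow> x < y \<Longrightarrow> adj x y
      \<Longrightarrow> x = u \<and> y = v"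
    using pat unfolding one_edge_pattern_def by blast+
  have emb: "\<exists>h. (\<forall>x\<in>verts H. P x \<longrightarrow> h x \<in> T) \<and>
      (\<forall>x\<in>verts H. \<forall>y\<in>verts H. P x \<longrightarrow> P y \<longrightarrow> ord H x < ord H y \<longrightarrow> h x < h y)"
    if "finite T" "card T = k" for P and T :: "nat set"
  proof -
    have "card {x \<in> verts H. P x} \<le> card T"
      using that(2) card_mono[OF finH, of "{x \<in> verts H. P x}"] k by auto
    then show ?thesis
      using ex_order_embedding[of "{x \<in> verts H. P x}" T "ord H"] finH that(1) by auto
  qed
  show ?thesis
  proof (rule edges_at_most_one[OF H])
    assume "edges H = {}"
    obtain h where h: "\<forall>x\<in>verts H. h x \<in> F"
      "\<forall>x\<in>verts H. \<forall>y\<in>verts H. ord H x < ord H y \<longrightarrow> h x < h y"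
      using emb[OF fin(1) cards(1), of "\<lambda>_. True"] by auto
    have "\<not> adj (h x) (h y)" if "x \<in> verts H" "y \<in> verts H" "h x < h y" for x y
      using only[of "h x" "h y"] F[of "h x"] h(1) that by auto
    then show ?thesis using h \<open>edges H = {}\<close> by (intro exI[of _ h]) auto
  next
    fix a b assume ab: "a \<in> verts H" "b \<in> verts H" "ord H a < ord H b" "edges H = {{a, b}}"
    obtain hF where hF: "\<forall>x\<in>verts H. ord H x < ord H a \<longrightarrow> hF x \<in> F"
      "\<forall>x\<in>verts H. \<forall>y\<in>verts H. ord H x < ord H a \<longrightarrow> ord H y < ord H a \<longrightarrow>
        ord H x < ord H y \<longrightarrow> hF x < hF y"
      using emb[OF fin(1) cards(1), of "\<lambda>x. ord H x < ord H a"] by blast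
    obtain hM where hM: "\<forall>x\<in>verts H. ord H a < ord H x \<and> ord H x < ord H b \<longrightarrow> hM x \<in> M"
      "\<forall>x\<in>verts H. \<forall>y\<in>verts H. ord H a < ord H x \<and> ord H x < ord H b \<longrightarrow> ord H a < ord H y \<and> ord H y < ord H b \<longrightarrow>
        ord H x < ord H y \<longrightarrow> hM x < hM y"
      using emb[OF fin(2) cards(2), of "\<lambda>x. ord H a < ord H x \<and> ord H x < ord H b"] by blast
    obtain hB where hB: "\<forall>x\<in>verts H. ord H b < ord H x \<longrightarrow> hB x \<in> B"
      "\<forall>x\<in>verts H. \<forall>y\<in>verts H. ord H b < ord H x \<longrightarrow> ord H b < ord H y \<longrightarrow>
        ord H x < ord H y \<longrightarrow> hB x < hB y"
      using emb[OF fin(3) cards(3), of "\<lambda>x. ord H b < ord H x"] by blast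
    define h where "h x = (if ord H x < ord H a then hF x else if ord H x = ord H a then u
      else if ord H x < ord H b then hM x else if ord H x = ord H b then v else hB x)" for x
    have pieces: "ord H x < ord H a \<Longrightarrow> h x = hF x" "ord H x = ord H a \<Longrightarrow> h x = u"
      "ord H a < ord H x \<Longrightarrow> ord H x < ord H b \<Longrightarrow> h x = hM x" "ord H x = ord H b \<Longrightarrow> h x = v"
      "ord H b < ord H x \<Longrightarrow> h x = hB x" for x
      using ab(3) by (auto simp: h_def)
    have val: "(ord H x < ord H a \<and> h x \<in> F \<and> h x < u) \<or> (ord H x = ord H a \<and> h x = u) \<or>
        (ord H a < ord H x \<and> ord H x < ord H b \<and> h x \<in> M \<and> u < h x \<and> h x < v) \<or>
        (ord H x = ord H b \<and> h x = v) \<or> (ord H b < ord H x \<and> h x \<in> B \<and> v < h x)"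
      if "x \<in> verts H" for x
    proof -
      consider "ord H x < ord H a" | "ord H x = ord H a" | "ord H a < ord H x" "ord H x < ord H b"
        | "ord H x = ord H b" | "ord H b < ord H x" by linarith
      then show ?thesis
        using that by cases (simp_all add: pieces hF hM hB F M B)
    qed
    \<comment> \<open>The pattern only forces \<open>u < v\<close> through an element of \<open>M\<close>, and \<open>k\<close> is positive because \<open>H\<close> has an edge.\<close>
    have "0 < card (verts H)" using ab(1) finH by (auto simp: card_gt_0_iff)
    then have "M \<noteq> {}" using k cards(2) by auto
    then have "u < v" using M by fastforce
    have mono: "h x < h y" if "x \<in> verts H" "y \<in> verts H" "ord H x < ord H y" for x y
    proof -
      consider (below) "ord H y < ord H a" | (between) "ord H a < ord H x" "ord H y < ord H b"
        | (above) "ord H b < ord H x"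
        | (mixed) "ord H a \<le> ord H y" "ord H x \<le> ord H a \<or> ord H b \<le> ord H y" "ord H x \<le> ord H b"
        by linarith
      then show ?thesis
      proof cases
        case mixed
        then show ?thesis
          using val[OF that(1)] val[OF that(2)] that(3) \<open>u < v\<close> ab(3) by (elim disjE conjE) linarith+
      qed (use that hF(2) hM(2) hB(2) in \<open>simp_all add: pieces\<close>)
    qed
    have sub: "h ` verts H \<subseteq> F \<union> M \<union> B \<union> {u, v}"
      using val by blast
    have "adj (h x) (h y) \<longleftrightarrow> {x, y} \<in> edges H"
      if xy: "x \<in> verts H" "y \<in> verts H" "ord H x < ord H y" for x y
    proof
      assume "adj (h x) (h y)"
      then have "h x = u" "h y = v"
        using only[of "h x" "h y"] sub xy mono[OF xy] by auto
      then have "ord H x = ord H a" "ord H y = ord H b"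
        using val[OF xy(1)] val[OF xy(2)] \<open>u < v\<close> by auto
      then have "x = a" "y = b"
        using H(1) xy ab by (auto simp: ordered_graph_def dest: inj_onD)
      then show "{x, y} \<in> edges H" using ab(4) by simp
    next
      assume "{x, y} \<in> edges H"
      then have "x = a \<and> y = b" using ab(3,4) xy(3) by (auto simp: doubleton_eq_iff)
      then show "adj (h x) (h y)" using uv pieces(2,4) by simp
    qed
    then show ?thesis using sub mono by blast
  qed
qed

lemma not_free_if_embedding:
  assumes H: "ordered_graph H" and G: "ordered_graph G"
    and h: "h ` verts H \<subseteq> {..<length (ordered_verts G)}"
    and emb: "\<And>x y. x \<in> verts H \<Longrightarrow> y \<in> verts H \<Longrightarrow> ord H x < ord H y \<Longrightarrow>
      h x < h y \<and> (graph_adj G (h x) (h y) \<longleftrightarrow> {x, y} \<in> edges H)"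
  shows "\<not> free H G"
proof -
  let ?vs = "ordered_verts G"
  define e where "e x = ?vs ! h x" for x
  have hl: "h x < length ?vs" if "x \<in> verts H" for x using h that by auto
  have "inj_on (ord H) (verts H)" using H by (simp add: ordered_graph_def)
  then have cases: "x = y \<or> ord H x < ord H y \<or> ord H y < ord H x" if "x \<in> verts H" "y \<in> verts H" for x y
    using that by (metis inj_on_eq_iff linorder_neqE)
  have ord: "ord G (e x) < ord G (e y)" if "x \<in> verts H" "y \<in> verts H" "ord H x < ord H y" for x y
    unfolding e_def using emb[OF that] hl[OF that(2)] by (intro ordered_verts(3)[OF G]) auto
  have ord_iff: "ord G (e x) < ord G (e y) \<longleftrightarrow> ord H x < ord H y" if "x \<in> verts H" "y \<in> verts H" for x y
    using cases[OF that] ord[OF that] ord[OF that(2,1)] by auto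
  have edge: "{e x, e y} \<in> edges G \<longleftrightarrow> {x, y} \<in> edges H" if xy: "x \<in> verts H" "y \<in> verts H" for x y
  proof -
    consider "x = y" | "ord H x < ord H y" | "ord H y < ord H x" using cases[OF xy] by blast
    then show ?thesis
    proof cases
      case 1
      then show ?thesis using H G by (auto simp: ordered_graph_def)
    next
      case 2
      then show ?thesis using emb[OF xy 2] by (simp add: graph_adj_def e_def)
    next
      case 3
      then show ?thesis using emb[OF xy(2,1) 3] by (simp add: graph_adj_def e_def insert_commute)
    qed
  qed
  have inj: "inj_on e (verts H)"
  proof (rule inj_onI)
    fix x y assume xy: "x \<in> verts H" "y \<in> verts H" "e x = e y"
    then show "x = y" using cases[OF xy(1,2)] ord[OF xy(1,2)] ord[OF xy(2,1)] by auto
  qed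
  let ?f = "inv_into (verts H) e"
  have f: "?f (e x) = x" if "x \<in> verts H" for x using inj that by simp
  have "isomorphic H (induced G (e ` verts H))"
    unfolding isomorphic_def
  proof (intro exI[of _ ?f] conjI ballI)
    show "bij_betw ?f (verts (induced G (e ` verts H))) (verts H)"
      using inj by (simp add: induced_def bij_betw_inv_into inj_on_imp_bij_betw)
  next
    fix p q assume "p \<in> verts (induced G (e ` verts H))" "q \<in> verts (induced G (e ` verts H))"
    then obtain x y where xy: "x \<in> verts H" "p = e x" "y \<in> verts H" "q = e y"
      by (auto simp: induced_def)
    show "(ord (induced G (e ` verts H)) p < ord (induced G (e ` verts H)) q) \<longleftrightarrow>
        ord H (?f p) < ord H (?f q)"
      using ord_iff[OF xy(1,3)] xy f by (simp add: induced_def)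
    show "({p, q} \<in> edges (induced G (e ` verts H))) \<longleftrightarrow> {?f p, ?f q} \<in> edges H"
      using edge[OF xy(1,3)] xy f by (simp add: induced_def)
  qed
  moreover have "e ` verts H \<subseteq> verts G"
    using hl ordered_verts(1)[OF G] nth_mem unfolding e_def by blast
  ultimately show ?thesis unfolding free_def induced_subgraph_def by blast
qed

section \<open>The algorithm\<close>

theorem theorem5:
  fixes H :: "'a ograph"
  assumes "ordered_graph H" and "card (edges H) \<le> 1"
  shows "poly_time_solvable encode {(G, L) \<in> list3col_instances. free H G} list3col_yes"
proof -
  \<comment> \<open>The successor makes \<open>k\<close> positive also if \<open>H\<close> has no vertices; the update of windows needs this.\<close>
  define k where "k = Suc (card (verts H))"
  define N where "N n = Suc n * (Suc n ^ k) ^ 9" for n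
  have k: "0 < k" by (simp add: k_def)
  show ?thesis
  proof (rule poly_time_by_table[where N = N and body = "dp_step k" and final = "dp_answer k"])
    show "definable (\<lambda>w A v. N (v 0))" unfolding N_def by (intro definable_arith)
    show "definable (\<lambda>w A v. dp_step k w A (v 0) (v 1))" by (rule definable_dp_step)
    show "definable (\<lambda>w A v. dp_answer k w A (v 0))" by (rule definable_dp_answer)
    fix x :: inst assume x: "x \<in> {(G, L) \<in> list3col_instances. free H G}"
    obtain G L where GL: "x = (G, L)" by fastforce
    have G: "ordered_graph G" and free: "free H G"
      using x GL by (auto simp: list3col_instances_def)
    define w where "w = encode (G, L)"
    define n where "n = length (ordered_verts G)"
    define g where "g s = (of_bool (reachable (adj_bit w n) (list_bit w n) n k s) :: nat)" for s
    have adj: "adj_bit w n u v = graph_adj G u v" if "u < n" "v < n" for u v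
      using adj_bit_encode that unfolding w_def n_def by blast
    have lst: "list_bit w n v i = (Suc i \<in> L (ordered_verts G ! v))" if "v < n" "i < 3" for v i
      using list_bit_encode that unfolding w_def n_def by blast
    have no_pattern: "\<not> one_edge_pattern (adj_bit w n) k F u M v B"
      if sub: "F \<union> M \<union> B \<union> {u, v} \<subseteq> {..<n}" for F u M v B
    proof
      assume pat: "one_edge_pattern (adj_bit w n) k F u M v B"
      have "finite F" "finite M" "finite B" using sub finite_subset by auto
      then obtain h where h: "h ` verts H \<subseteq> F \<union> M \<union> B \<union> {u, v}"
        "\<forall>x\<in>verts H. \<forall>y\<in>verts H. ord H x < ord H y \<longrightarrow>
          h x < h y \<and> (adj_bit w n (h x) (h y) \<longleftrightarrow> {x, y} \<in> edges H)"
        using pattern_embedding[OF assms _ _ _ _ pat] by (auto simp: k_def)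
      have hn: "h ` verts H \<subseteq> {..<n}" using h(1) sub by blast
      have "\<not> free H G"
      proof (rule not_free_if_embedding[OF assms(1) G])
        show "h ` verts H \<subseteq> {..<length (ordered_verts G)}" using hn by (simp add: n_def)
        show "h x < h y \<and> (graph_adj G (h x) (h y) \<longleftrightarrow> {x, y} \<in> edges H)"
          if "x \<in> verts H" "y \<in> verts H" "ord H x < ord H y" for x y
          using h(2) that adj[of "h x" "h y"] hn by blast
      qed
      then show False using free by blast
    qed
    have "list3col_yes x \<longleftrightarrow> colorable (adj_bit w n) (list_bit w n) n"
      unfolding GL list3col_yes_def using list_coloring_iff_colorable[OF G, of L]
        colorable_cong[OF adj lst] by (simp add: n_def)
    also have "\<dots> \<longleftrightarrow> (\<exists>s<N n. reachable (adj_bit w n) (list_bit w n) n k s \<and> accepting n k s)"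
      unfolding N_def using adj graph_adj_commute[of G] graph_adj_irrefl[OF G] no_pattern
      by (intro colorable_iff_reachable k) auto
    finally have "dp_answer k w (\<lambda>j. if j < N n then g j else 0) n = of_bool (list3col_yes x)"
      unfolding dp_answer_def N_def[symmetric] g_def by (auto simp: of_bool_def)
    moreover have "g s = dp_step k w (\<lambda>j. if j < s then g j else 0) n s" for s
      unfolding dp_step_def g_def by (subst reachable_iff[OF k]) (auto simp: of_bool_def)
    moreover have "starts_unary w n"
      using starts_unary_encode unfolding w_def n_def .
    moreover have "g s \<le> 1" for s by (simp add: g_def)
    ultimately show "\<exists>n g. starts_unary (encode x) n \<and>
      (\<forall>s<N n. g s \<le> 1 \<and> g s = dp_step k (encode x) (\<lambda>j. if j < s then g j else 0) n s) \<and>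
      dp_answer k (encode x) (\<lambda>j. if j < N n then g j else 0) n = of_bool (list3col_yes x)"
      unfolding GL w_def[symmetric] by blast
  qed
qed

end
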